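(* Let $1\le k\le n$. (1) For any point $A$ in $Gr^+(k,n)$ and any maximal (by containment) sorted subset $S\subset\binom{[n]}{k}$, there is a unique point $A'$ of $Gr^+(k,n)$ obtained from $A$ by the torus action (that is, by rescaling the columns of the $k\times n$ matrix $A$ by positive scalars) such that the Plücker coordinates $\Delta_I$ of $A'$, for all $I\in S$, are equal to each other. (2) All other Plücker coordinates $\Delta_J$, $J\in\binom{[n]}{k}\setminus S$, for the point $A'$ are strictly less than the $\Delta_I$, for $I\in S$.
   Context: $[n]=\{1,\dots,n\}$ and $\binom{[n]}{k}$ is the set of $k$-element subsets of $[n]$. The Grassmannian $Gr(k,n)$ over $\mathbb{R}$ is the space of $k$-dimensional linear subspaces of $\mathbb{R}^n$, identified with real $k\times n$ matrices of rank $k$ modulo row operations. For $I\in\binom{[n]}{k}$, the Plücker coordinate $\Delta_I$ is the $k\times k$ minor in the column set $I$; the $\Delta_I$ are projective coordinates (defined up to a common nonzero factor). The positive Grassmannian $Gr^+(k,n)$ is the set of points of $Gr(k,n)$ all of whose Plücker coordinates have the same nonzero sign; we always choose a representative with $\Delta_I>0$ for all $I$. The positive torus $\mathbb{R}_{>0}^n$ acts on $Gr^+(k,n)$ by rescaling the coordinates in $\mathbb{R}^n$; in terms of $k\times n$ matrices, $(t_1,\dots,t_n)$ multiplies the $i$-th column by $t_i$. Two sets $I,J\in\binom{[n]}{k}$ are sorted if, writing $I\setminus J=\{a_1<\dots<a_r\}$ and $J\setminus I=\{b_1<\dots<b_r\}$, one has $a_1<b_1<a_2<b_2<\dots<a_r<b_r$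 or the same inequalities with the $a$'s and $b$'s switched. A subset of $\binom{[n]}{k}$ is sorted if every two elements in it are sorted. *)

theory Defs
  imports Complex_Main "Jordan_Normal_Form.VS_Connect" "Jordan_Normal_Form.DL_Submatrix"
begin

text \<open>
  Matrices and vectors are indexed from 0, so the ground set $[n]$ is rendered as \<open>{..<n}\<close>;
  sortedness only depends on the order of the indices.
\<close>

definition ksubsets :: "nat \<Rightarrow> nat \<Rightarrow> nat set set" where
  "ksubsets k n = {I. I \<subseteq> {..<n} \<and> card I = k}"

definition grassmannian :: "nat \<Rightarrow> nat \<Rightarrow> real vec set set" where
  "grassmannian k n =
     {U. VectorSpace.subspace class_ring U (module_vec TYPE(real) n) \<and>
         vectorspace.dim class_ring (module_vec TYPE(real) n\<lparr>carrier := U\<rparr>) = k}"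

text \<open>
  For a point \<open>U\<close> of the Grassmannian a representing matrix automatically has rank \<open>k\<close>, and it is
  determined by \<open>U\<close> up to row operations.
\<close>

definition represents :: "nat \<Rightarrow> nat \<Rightarrow> real mat \<Rightarrow> real vec set \<Rightarrow> bool" where
  "represents k n A U \<longleftrightarrow> A \<in> carrier_mat k n \<and> vec_space.row_space n A = U"

definition plucker :: "real mat \<Rightarrow> nat set \<Rightarrow> real" where
  "plucker A I = det (submatrix A UNIV I)"

definition positive_grassmannian :: "nat \<Rightarrow> nat \<Rightarrow> real vec set set" where
  "positive_grassmannian k n =
     {U \<in> grassmannian k n. \<exists>A. represents k n A U \<and>
        ((\<forall>I\<in>ksubsets k n. plucker A I > 0) \<or> (\<forall>I\<in>ksubsets k n. plucker A I < 0))}"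

definition positively_represents :: "nat \<Rightarrow> nat \<Rightarrow> real mat \<Rightarrow> real vec set \<Rightarrow> bool" where
  "positively_represents k n A U \<longleftrightarrow>
     represents k n A U \<and> (\<forall>I\<in>ksubsets k n. plucker A I > 0)"

definition pluckers_equal_on :: "nat \<Rightarrow> nat \<Rightarrow> nat set set \<Rightarrow> real vec set \<Rightarrow> bool" where
  "pluckers_equal_on k n S U \<longleftrightarrow>
     (\<forall>A. positively_represents k n A U \<longrightarrow> (\<forall>I\<in>S. \<forall>J\<in>S. plucker A I = plucker A J))"

definition torus_act :: "nat \<Rightarrow> (nat \<Rightarrow> real) \<Rightarrow> real vec set \<Rightarrow> real vec set" where
  "torus_act n t U = (\<lambda>v. vec n (\<lambda>i. t i * v $ i)) ` U"

definition torus_orbit :: "nat \<Rightarrow> real vec set \<Rightarrow> real vec set set" where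
  "torus_orbit n U = {torus_act n t U | t. \<forall>i<n. t i > 0}"

text \<open>For lists of equal length, \<^term>\<open>splice as bs\<close> is $a_1, b_1, a_2, b_2, \dots, a_r, b_r$.\<close>

definition sorted_pair :: "nat set \<Rightarrow> nat set \<Rightarrow> bool" where
  "sorted_pair I J \<longleftrightarrow>
     (let as = sorted_list_of_set (I - J); bs = sorted_list_of_set (J - I)
      in sorted_wrt (<) (splice as bs) \<or> sorted_wrt (<) (splice bs as))"

definition sorted_subset :: "nat \<Rightarrow> nat \<Rightarrow> nat set set \<Rightarrow> bool" where
  "sorted_subset k n S \<longleftrightarrow> S \<subseteq> ksubsets k n \<and> (\<forall>I\<in>S. \<forall>J\<in>S. sorted_pair I J)"

definition maximal_sorted_subset :: "nat \<Rightarrow> nat \<Rightarrow> nat set set \<Rightarrow> bool" where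
  "maximal_sorted_subset k n S \<longleftrightarrow>
     sorted_subset k n S \<and> (\<forall>T. sorted_subset k n T \<and> S \<subseteq> T \<longrightarrow> T = S)"

text \<open>On matrices the torus rescales the columns.\<close>

lemma represents_torus_act:
  assumes "represents k n A U"
  shows "represents k n (mat k n (\<lambda>(i,j). t j * A $$ (i,j))) (torus_act n t U)"
proof -
  let ?B = "mat k n (\<lambda>(i,j). t j * A $$ (i,j))"
  have A: "A \<in> carrier_mat k n" and U: "vec_space.row_space n A = U"
    using assms by (auto simp: represents_def)
  have B: "?B \<in> carrier_mat k n" by simp
  have eq: "?B\<^sup>T *\<^sub>v y = vec n (\<lambda>i. t i * (A\<^sup>T *\<^sub>v y) $ i)" if "y \<in> carrier_vec k" for y
    using that A by (intro eq_vecI) (auto simp: scalar_prod_def sum_distrib_left mult.assoc)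
  have rows: "vec_space.row_space n M = (\<lambda>y. M\<^sup>T *\<^sub>v y) ` carrier_vec k"
    if M: "M \<in> carrier_mat k n" for M :: "real mat"
    using M unfolding vec_space.row_space_eq[OF M] by (auto intro!: carrier_vecI)
  have "vec_space.row_space n ?B = torus_act n t U"
    unfolding torus_act_def U[symmetric] rows[OF A] rows[OF B] image_image
    using eq by (intro image_cong) auto
  then show ?thesis using B by (simp add: represents_def)
qed

text \<open>
  Positive representatives exist, so statements quantified over all of them are not vacuous.
\<close>

lemma positively_represents_exists:
  assumes k: "1 \<le> k" and U: "U \<in> positive_grassmannian k n"
  shows "\<exists>A. positively_represents k n A U"
proof -
  obtain A where A: "represents k n A U"
    and sgn: "(\<forall>I\<in>ksubsets k n. plucker A I > 0) \<or> (\<forall>I\<in>ksubsets k n. plucker A I < 0)"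
    using U by (auto simp: positive_grassmannian_def)
  show ?thesis
  proof (cases "\<forall>I\<in>ksubsets k n. plucker A I > 0")
    case True
    then show ?thesis using A by (auto simp: positively_represents_def)
  next
    case False
    then have neg: "\<forall>I\<in>ksubsets k n. plucker A I < 0" using sgn by blast
    have Ac: "A \<in> carrier_mat k n" and Au: "vec_space.row_space n A = U"
      using A by (auto simp: represents_def)
    define P where "P = multrow_mat k 0 (-1 :: real)"
    have Pc: "P \<in> carrier_mat k k" by (simp add: P_def)
    have PA: "P * A = multrow 0 (-1) A"
      unfolding P_def using multrow_mat[OF Ac] by simp
    have Pi: "invertible_mat P"
    proof -
      have "P * P = multrow 0 (-1) P"
        using multrow_mat[OF Pc] by (simp add: P_def)
      also have "\<dots> = 1\<^sub>m k"
        by (rule eq_matI) (auto simp: P_def)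
      finally show ?thesis using Pc by (auto simp: invertible_mat_def inverts_mat_def)
    qed
    have "vec_space.row_space n (P * A) = U"
      using vec_space.row_space_is_preserved[OF Pi Pc Ac] Au by simp
    then have rep: "represents k n (P * A) U"
      using Pc Ac by (simp add: represents_def)
    have "plucker (P * A) I > 0" if I: "I \<in> ksubsets k n" for I
    proof -
      have cI: "{j. j < n \<and> j \<in> I} = I" using I by (auto simp: ksubsets_def)
      have card: "card I = k" using I by (simp add: ksubsets_def)
      have pick: "pick I j < n" if "j < k" for j
        using pick_le[of j n I] cI card that by simp
      have sc: "submatrix A UNIV I \<in> carrier_mat k k"
        using Ac cI card by (auto simp: submatrix_def)
      have "submatrix (P * A) UNIV I = multrow 0 (-1) (submatrix A UNIV I)"
        unfolding PA using Ac cI card pick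
        by (intro eq_matI) (auto simp: submatrix_def pick_UNIV)
      then have "plucker (P * A) I = - plucker A I"
        using det_multrow[OF _ sc, of 0 "-1"] k by (simp add: plucker_def)
      then show ?thesis using neg I by simp
    qed
    then show ?thesis using rep by (auto simp: positively_represents_def)
  qed
qed

end

theory Submission
  imports Defs "Jordan_Normal_Form.DL_Rank_Submatrix"
begin

text \<open>
  Write \<open>f I\<close> for the logarithm of the Pluecker coordinate of \<open>I\<close>. The torus changes \<open>f\<close> by
  linear functions of the indicator vector of \<open>I\<close>. Positivity and the three-term relation
  (\<open>plucker_three_term\<close>) make \<open>f\<close> strictly concave in a discrete sense, and the maximal sorted
  collections are the regions of linearity that such an \<open>f\<close> induces: there is a unique linear
  function that agrees with \<open>f\<close> on \<open>S\<close>, and it is strictly larger than \<open>f\<close> elsewhere.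
  
  To see this without geometry, encode a \<open>k\<close>-subset as a path on the integers with steps 0 and 1,
  periodic up to a climb of \<open>k\<close> per period \<open>n\<close>, which is determined up to an additive constant.
  Two subsets are sorted exactly if the paths representing them, at all heights, are pairwise comparable
  in the pointwise order (\<open>sorted_pair_iff_height\<close>, \<open>lifts_chain\<close>). A maximal sorted \<open>S\<close> with \<open>k < n\<close>
  is therefore a maximal shift-invariant chain of paths, and in it each path is obtained from the
  previous one by raising it by 1 at a single residue class (\<open>exists_successor\<close>), each class being
  raised once per period (\<open>raise_unique\<close>, \<open>exists_raise_at\<close>).
  
  A raise at \<open>c\<close> replaces the element \<open>c\<close> by its cyclic predecessor, so it changes a linear function by the
  difference of two neighbouring weights. The differences for nonzero \<open>c\<close> can be prescribed freely
  and determine the weights up to a constant, which yields existence (\<open>weights_exist\<close>) and uniqueness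
  (\<open>constant_of_constant_sums\<close>) of the weights.
  
  For the strict inequality, the three-term relation amounts to strict supermodularity on a square
  formed by two raises (\<open>raise_square\<close>), and telescoping gives an exchange inequality for longer
  distances (\<open>raise_exchange\<close>). Normalise \<open>f\<close> to vanish on \<open>S\<close> and let \<open>J\<close> be outside \<open>S\<close>. Between the
  largest path \<open>q\<close> of the chain below \<open>J\<close> and its successor, which is a raise at some \<open>c\<close>, the exchange
  inequality says that raising \<open>J\<close> at \<open>c\<close> strictly increases the value of \<open>J\<close>. A maximal nonnegative
  value outside \<open>S\<close> is therefore impossible (\<open>negative_outside\<close>). For \<open>k = n\<close> the Grassmannian is a point.
\<close>

section \<open>The three-term Pluecker relation\<close>

text \<open>
  Minors are taken along a list of columns in any order, possibly with repetitions: then the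
  determinant is alternating and multilinear in the list, and the signs caused by sorting the
  columns are collected separately in \<open>list_minor_insort\<close>.
\<close>

definition list_minor :: "'a::field mat \<Rightarrow> nat list \<Rightarrow> 'a" where
  "list_minor A js = det (mat (dim_row A) (length js) (\<lambda>(i, j). A $$ (i, js ! j)))"

lemma list_minor_swap:
  assumes "length xs + length ys + 2 = dim_row A"
  shows "list_minor A (xs @ b # a # ys) = - list_minor A (xs @ a # b # ys)"
proof -
  let ?m = "length xs" and ?k = "dim_row A"
  let ?M = "mat ?k ?k (\<lambda>(i, j). A $$ (i, (xs @ a # b # ys) ! j))"
  have "mat ?k ?k (\<lambda>(i, j). A $$ (i, (xs @ b # a # ys) ! j)) = swapcols ?m (Suc ?m) ?M"
    using assms by (intro eq_matI) (auto simp: nth_append nth_Cons split: nat.splits)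
  moreover have "det (swapcols ?m (Suc ?m) ?M) = - det ?M"
    using assms by (intro det_swapcols[of _ ?k]) auto
  moreover have "length (xs @ a # b # ys) = ?k" "length (xs @ b # a # ys) = ?k"
    using assms by auto
  ultimately show ?thesis unfolding list_minor_def by simp
qed

lemma list_minor_repeated:
  assumes "length js = dim_row A" "\<not> distinct js"
  shows "list_minor A js = 0"
proof -
  obtain i j where ij: "i < length js" "j < length js" "i \<noteq> j" "js ! i = js ! j"
    using assms(2) by (auto simp: distinct_conv_nth)
  show ?thesis unfolding list_minor_def
    using assms(1) ij by (intro det_identical_columns[of _ "dim_row A" i j]) auto
qed

lemma list_minor_Cons_linear:
  assumes "Suc (length js) = dim_row A"
  obtains w where "\<And>a. list_minor A (a # js) = (\<Sum>i<dim_row A. A $$ (i, a) * w i)"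
proof -
  let ?k = "dim_row A"
  define M where "M a = mat ?k ?k (\<lambda>(i, j). A $$ (i, (a # js) ! j))" for a
  have del: "mat_delete (M a) i 0 = mat_delete (M b) i 0" for a b i
    unfolding mat_delete_def M_def by (intro eq_matI) (auto simp: nth_Cons split: nat.splits)
  have "list_minor A (a # js) = (\<Sum>i<?k. A $$ (i, a) * cofactor (M 0) i 0)" for a
  proof -
    have "list_minor A (a # js) = det (M a)"
      unfolding list_minor_def M_def using assms by simp
    also have "\<dots> = (\<Sum>i<?k. M a $$ (i, 0) * cofactor (M a) i 0)"
      using assms by (intro laplace_expansion_column) (auto simp: M_def)
    also have "\<dots> = (\<Sum>i<?k. A $$ (i, a) * cofactor (M 0) i 0)"
      using assms del[of a _ 0] by (intro sum.cong) (auto simp: M_def cofactor_def)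
    finally show ?thesis .
  qed
  then show thesis by (rule that)
qed

text \<open>
  The difference of the two sides is a linear form in the column \<open>c\<close>, by expansion of each
  minor along that column. It vanishes when \<open>c\<close> is \<open>a\<close>, \<open>b\<close> or a column of \<open>s\<close>, because the
  determinant is alternating. These columns form a basis, as their minor is nonzero, so the
  linear form is zero.
\<close>

lemma three_term_plucker_relation:
  assumes len: "length s + 2 = dim_row A" and nz: "list_minor A (a # b # s) \<noteq> 0"
  shows "list_minor A (a # c # s) * list_minor A (b # d # s) =
    list_minor A (a # b # s) * list_minor A (c # d # s) +
    list_minor A (a # d # s) * list_minor A (b # c # s)"
proof -
  let ?k = "dim_row A" and ?D = "list_minor A"
  have swap: "?D (y # x # s) = - ?D (x # y # s)" for x y
    using list_minor_swap[of "[]" s A y x] len by simp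
  have rep: "?D (x # x # s) = 0" for x
    using len by (intro list_minor_repeated) auto
  have rep1: "?D (x # y # s) = 0" if "x \<in> set s" for x y
    using len that by (intro list_minor_repeated) auto
  have rep2: "?D (x # y # s) = 0" if "y \<in> set s" for x y
    using len that by (intro list_minor_repeated) auto
  have "\<exists>w. \<forall>x. ?D (x # y # s) = (\<Sum>i<?k. A $$ (i, x) * w i)" for y
    using list_minor_Cons_linear[of "y # s" A] len by (metis add_2_eq_Suc' length_Cons)
  then obtain w where w: "?D (x # y # s) = (\<Sum>i<?k. A $$ (i, x) * w y i)" for x y
    by metis
  \<comment> \<open>the coefficient vector of \<open>defect\<close> below, as a linear form in the column \<open>x\<close>\<close>
  define W where "W i = - ?D (b # d # s) * w a i - ?D (a # b # s) * w d i + ?D (a # d # s) * w b i" for i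
  define defect where "defect x = ?D (a # x # s) * ?D (b # d # s) - ?D (a # b # s) * ?D (x # d # s)
    - ?D (a # d # s) * ?D (b # x # s)" for x
  have lin: "defect x = (\<Sum>i<?k. A $$ (i, x) * W i)" for x
  proof -
    have "defect x = - ?D (b # d # s) * ?D (x # a # s) - ?D (a # b # s) * ?D (x # d # s)
       + ?D (a # d # s) * ?D (x # b # s)"
      unfolding defect_def swap[of a x] swap[of b x] by simp
    then show ?thesis
      unfolding w[of x] W_def
      by (simp add: sum_distrib_left sum_subtractf[symmetric] sum.distrib[symmetric] sum_negf[symmetric] algebra_simps)
  qed
  have zero: "defect x = 0" if "x \<in> set (a # b # s)" for x
    using that rep rep1 rep2 swap[of a b] by (auto simp: defect_def)
  let ?M = "mat ?k ?k (\<lambda>(i, j). A $$ (i, (a # b # s) ! j))"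
  have "?M\<^sup>T *\<^sub>v vec ?k W = 0\<^sub>v ?k"
  proof (rule eq_vecI)
    fix j assume "j < dim_vec (0\<^sub>v ?k :: 'a vec)"
    then have j: "j < ?k" by simp
    then have "(?M\<^sup>T *\<^sub>v vec ?k W) $ j = defect ((a # b # s) ! j)"
      unfolding lin by (simp add: scalar_prod_def atLeast0LessThan)
    also have "\<dots> = 0" using j len by (intro zero nth_mem) auto
    finally show "(?M\<^sup>T *\<^sub>v vec ?k W) $ j = 0\<^sub>v ?k $ j" using j by simp
  qed simp
  moreover have "det ?M\<^sup>T \<noteq> 0"
    using nz len det_transpose[of ?M ?k] by (simp add: list_minor_def)
  ultimately have "vec ?k W = 0\<^sub>v ?k"
    using det_0_iff_vec_prod_zero_field[of "?M\<^sup>T" ?k]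
    by (auto dest!: spec[of _ "vec ?k W"])
  then have "W i = 0" if "i < ?k" for i using that by (metis index_vec index_zero_vec(1))
  then have "defect c = 0" unfolding lin by simp
  then show ?thesis by (simp add: defect_def algebra_simps)
qed

lemma list_minor_insort:
  assumes "length zs + length xs + 1 = dim_row A" "sorted xs" "a \<notin> set xs"
  shows "list_minor A (zs @ insort a xs) =
    (-1) ^ length (filter (\<lambda>x. x < a) xs) * list_minor A (zs @ a # xs)"
  using assms
proof (induction xs arbitrary: zs)
  case (Cons x xs)
  show ?case
  proof (cases "a \<le> x")
    case True
    then have "filter (\<lambda>x. x < a) (x # xs) = []"
      using Cons.prems by (auto simp: filter_empty_conv)
    then show ?thesis using True by simp
  next
    case False
    have "list_minor A ((zs @ [x]) @ insort a xs) =
      (-1) ^ length (filter (\<lambda>x. x < a) xs) * list_minor A ((zs @ [x]) @ a # xs)"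
      using Cons.prems by (intro Cons.IH) auto
    then show ?thesis
      using False list_minor_swap[of zs xs A a x] Cons.prems by simp
  qed
qed simp

lemma map_pick_eq_sorted_list_of_set:
  assumes "finite I"
  shows "map (pick I) [0..<card I] = sorted_list_of_set I"
proof -
  have lt: "pick I i < pick I j" if "i < j" "j < card I" for i j
    using that pick_mono_le[of j I i] assms by (auto)
  have "sorted_wrt (<) (map (pick I) [0..<card I])"
    using lt by (auto simp: sorted_wrt_iff_nth_less)
  moreover have "set (map (pick I) [0..<card I]) = I"
  proof (rule card_subset_eq[OF assms])
    show "set (map (pick I) [0..<card I]) \<subseteq> I" using pick_in_set_le by auto
    have "inj_on (pick I) {0..<card I}"
    proof (rule inj_onI)
      fix i j assume "i \<in> {0..<card I}" "j \<in> {0..<card I}" "pick I i = pick I j"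
      then show "i = j" using lt[of i j] lt[of j i] by (cases i j rule: linorder_cases) auto
    qed
    then show "card (set (map (pick I) [0..<card I])) = card I" by (simp add: card_image)
  qed
  ultimately show ?thesis
    by (metis sorted_list_of_set.idem_if_sorted_distinct strict_sorted_iff)
qed

lemma plucker_eq_list_minor:
  assumes "A \<in> carrier_mat k n" "I \<in> ksubsets k n"
  shows "plucker A I = list_minor A (sorted_list_of_set I)"
proof -
  have I: "finite I" "I \<subseteq> {..<n}" "card I = k"
    using assms(2) finite_subset by (auto simp: ksubsets_def)
  have "{j. j < dim_col A \<and> j \<in> I} = I" using I assms(1) by auto
  moreover have "pick I j = sorted_list_of_set I ! j" if "j < k" for j
    using that I unfolding map_pick_eq_sorted_list_of_set[OF I(1), symmetric] by simp
  ultimately have "submatrix A UNIV I = mat k k (\<lambda>(i, j). A $$ (i, sorted_list_of_set I ! j))"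
    unfolding submatrix_def using assms(1) I by (auto simp: pick_UNIV intro!: eq_matI)
  then show ?thesis using assms(1) I by (simp add: plucker_def list_minor_def)
qed

lemma plucker_insert2:
  assumes A: "A \<in> carrier_mat k n" and R: "R \<subseteq> {..<n}" "card R + 2 = k"
    and ab: "a < b" "b < n" "a \<notin> R" "b \<notin> R"
  shows "plucker A (insert a (insert b R)) =
    (-1) ^ (card {x \<in> R. x < a} + card {x \<in> R. x < b}) *
    list_minor A (a # b # sorted_list_of_set R)"
proof -
  have fin: "finite R" using R finite_subset by auto
  have cnt: "length (filter (\<lambda>x. x < c) (sorted_list_of_set R)) = card {x \<in> R. x < c}" for c
    using fin by (simp flip: distinct_card) 
  let ?s = "sorted_list_of_set R"
  have "insert a (insert b R) \<in> ksubsets k n"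
    using R ab fin by (auto simp: ksubsets_def)
  then have "plucker A (insert a (insert b R)) = list_minor A (insort a (insort b ?s))"
    using plucker_eq_list_minor[OF A] fin ab by simp
  also have "\<dots> = (-1) ^ card {x \<in> R. x < a} * list_minor A (a # insort b ?s)"
  proof -
    have "{x \<in> insert b R. x < a} = {x \<in> R. x < a}" using ab by auto
    moreover have "length (filter (\<lambda>x. x < a) (insort b ?s)) = card {x \<in> insert b R. x < a}"
      using fin ab by (subst distinct_length_filter)
        (auto simp: distinct_insort set_insort_key intro!: arg_cong[of _ _ card])
    ultimately show ?thesis
      using list_minor_insort[of "[]" "insort b ?s" A a] fin ab R A by (simp add: set_insort_key sorted_insort)
  qed
  also have "list_minor A (a # insort b ?s) = (-1) ^ card {x \<in> R. x < b} * list_minor A (a # b # ?s)"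
    using list_minor_insort[of "[a]" ?s A b] fin ab R A cnt by simp
  finally show ?thesis by (simp add: power_add)
qed

text \<open>
  Moving \<open>x\<close> and \<open>y\<close> from the front of the column list to their sorted places costs the sign
  \<open>e x * e y\<close>. Each of the three products involves \<open>a\<close>, \<open>b\<close>, \<open>c\<close>, \<open>d\<close> once, so all three get the same
  sign, and the relation for lists becomes one for Pluecker coordinates, with plus signs only.
\<close>

lemma plucker_three_term:
  assumes A: "A \<in> carrier_mat k n" and R: "R \<subseteq> {..<n}" "card R + 2 = k"
    and abcd: "a < b" "b < c" "c < d" "d < n" and disj: "{a, b, c, d} \<inter> R = {}"
    and nz: "plucker A (insert a (insert b R)) \<noteq> 0"
  shows "plucker A (insert a (insert c R)) * plucker A (insert b (insert d R)) =
    plucker A (insert a (insert b R)) * plucker A (insert c (insert d R)) +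
    plucker A (insert a (insert d R)) * plucker A (insert b (insert c R))"
proof -
  let ?s = "sorted_list_of_set R"
  have "length ?s + 2 = dim_row A" using R A by simp
  moreover have "list_minor A (a # b # ?s) \<noteq> 0"
    using nz plucker_insert2[OF A R, of a b] abcd disj by auto
  ultimately have rel: "list_minor A (a # c # ?s) * list_minor A (b # d # ?s) =
    list_minor A (a # b # ?s) * list_minor A (c # d # ?s) +
    list_minor A (a # d # ?s) * list_minor A (b # c # ?s)"
    by (rule three_term_plucker_relation)
  define e where "e x = (-1 :: real) ^ card {y \<in> R. y < x}" for x
  have P: "plucker A (insert x (insert y R)) = e x * e y * list_minor A (x # y # ?s)"
    if "x < y" "y < n" "x \<notin> R" "y \<notin> R" for x y
    using plucker_insert2[OF A R that] by (simp add: e_def power_add)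
  have "plucker A (insert a (insert c R)) * plucker A (insert b (insert d R)) =
    e a * e b * e c * e d * (list_minor A (a # c # ?s) * list_minor A (b # d # ?s))"
    using abcd disj by (simp add: P)
  then show ?thesis unfolding rel using abcd disj by (simp add: P algebra_simps)
qed

section \<open>Subsets of the cycle as lattice paths\<close>

text \<open>
  A \<open>k\<close>-subset of \<open>{..<n}\<close> is the set of up-steps, within one period, of a path on the integers
  with steps 0 and 1 that climbs by \<open>k\<close> over each period \<open>n\<close>. The path is determined by the set up
  to an additive constant; working with bi-infinite quasi-periodic paths makes the cyclic symmetry
  of the problem visible and turns the pointwise order into the relevant structure.
\<close>

definition lattice_path :: "nat \<Rightarrow> nat \<Rightarrow> (int \<Rightarrow> int) \<Rightarrow> bool" where
  "lattice_path k n z \<longleftrightarrow>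
     (\<forall>j. z (j + int n) = z j + int k \<and> z j \<le> z (j + 1) \<and> z (j + 1) \<le> z j + 1)"

definition up_steps :: "nat \<Rightarrow> (int \<Rightarrow> int) \<Rightarrow> nat set" where
  "up_steps n z = {i. i < n \<and> z (int i + 1) = z (int i) + 1}"

text \<open>
  The path through \<open>(0, 0)\<close> with up-steps \<open>I\<close>.
\<close>

definition height :: "nat \<Rightarrow> nat set \<Rightarrow> int \<Rightarrow> int" where
  "height n I j = int (card (I \<inter> {..<nat (j mod int n)})) + int (card I) * (j div int n)"

text \<open>
  Raising a path by one at the residue class of \<open>c\<close> moves the element \<open>c\<close> of the corresponding set
  to its cyclic predecessor; these moves are the covering relations between paths.
\<close>

definition raise :: "nat \<Rightarrow> nat \<Rightarrow> (int \<Rightarrow> int) \<Rightarrow> int \<Rightarrow> int" where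
  "raise n c z = (\<lambda>j. z j + (if j mod int n = int c then 1 else 0))"

definition cyc_pred :: "nat \<Rightarrow> nat \<Rightarrow> nat" where
  "cyc_pred n c = (if c = 0 then n - 1 else c - 1)"

text \<open>
  A rank function for the pointwise order on paths, used as the measure in inductions.
\<close>

definition area :: "nat \<Rightarrow> (int \<Rightarrow> int) \<Rightarrow> int" where
  "area n z = (\<Sum>i<n. z (int i))"

lemma path_period_mult:
  assumes "lattice_path k n z"
  shows "z (j + m * int n) = z j + m * int k"
proof (induction m rule: int_induct[where k = 0])
  case (step1 i)
  have "z (j + (i + 1) * int n) = z ((j + i * int n) + int n)" by (simp add: algebra_simps)
  also have "\<dots> = z (j + i * int n) + int k" using assms unfolding lattice_path_def by blast
  finally show ?case using step1 by (simp add: algebra_simps)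
next
  case (step2 i)
  have "z (j + i * int n) = z ((j + (i - 1) * int n) + int n)" by (simp add: algebra_simps)
  also have "\<dots> = z (j + (i - 1) * int n) + int k" using assms unfolding lattice_path_def by blast
  finally show ?case using step2 by (simp add: algebra_simps)
qed simp

lemma path_mod:
  assumes "lattice_path k n z"
  shows "z j = z (j mod int n) + (j div int n) * int k"
    and "z (j + 1) = z (j mod int n + 1) + (j div int n) * int k"
    and "z (j - 1) = z (j mod int n - 1) + (j div int n) * int k"
proof -
  have j: "j = j mod int n + (j div int n) * int n" by simp
  show "z j = z (j mod int n) + (j div int n) * int k"
    using path_period_mult[OF assms, of "j mod int n" "j div int n"] by simp
  show "z (j + 1) = z (j mod int n + 1) + (j div int n) * int k"
    using path_period_mult[OF assms, of "j mod int n + 1" "j div int n"]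
    by (metis add.commute add.left_commute j)
  show "z (j - 1) = z (j mod int n - 1) + (j div int n) * int k"
    using path_period_mult[OF assms, of "j mod int n - 1" "j div int n"]
    by (metis add_diff_eq add.commute diff_add_eq j)
qed

lemma path_leI:
  assumes "lattice_path k n z" "lattice_path k n w" "0 < n" "\<And>i. i < n \<Longrightarrow> z (int i) \<le> w (int i)"
  shows "z \<le> w"
proof (rule le_funI)
  fix j
  have "z (int (nat (j mod int n))) \<le> w (int (nat (j mod int n)))"
    using assms(3) by (intro assms(4)) (simp add: nat_less_iff)
  then show "z j \<le> w j"
    using assms(3) path_mod(1)[OF assms(1), of j] path_mod(1)[OF assms(2), of j] by simp
qed

lemma path_shift: "lattice_path k n z \<Longrightarrow> lattice_path k n (\<lambda>j. z j + m)"
  unfolding lattice_path_def by auto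

lemma up_steps_shift: "up_steps n (\<lambda>j. z j + m) = up_steps n z"
  unfolding up_steps_def by auto

lemma card_Int_lessThan_Suc:
  "card (I \<inter> {..<Suc r}) = card (I \<inter> {..<r}) + of_bool (r \<in> I)"
  by (simp add: lessThan_Suc)

lemma height_eq:
  assumes "I \<subseteq> {..<n}" "r \<le> n" "0 < n"
  shows "height n I (q * int n + int r) = int (card (I \<inter> {..<r})) + int (card I) * q"
proof (cases "r = n")
  case True
  have "q * int n + int n = (q + 1) * int n" by (simp add: algebra_simps)
  moreover have "I \<inter> {..<n} = I" using assms by auto
  ultimately show ?thesis using True assms by (simp add: height_def algebra_simps)
next
  case False
  then show ?thesis using assms by (simp add: height_def)
qed

lemma height_of_nat:
  assumes "I \<subseteq> {..<n}" "r \<le> n" "0 < n"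
  shows "height n I (int r) = int (card (I \<inter> {..<r}))"
  using height_eq[OF assms, of 0] by simp

lemma height_step:
  assumes "I \<subseteq> {..<n}" "0 < n"
  shows "height n I (j + 1) = height n I j + of_bool (nat (j mod int n) \<in> I)"
proof -
  define q r where "q = j div int n" and "r = nat (j mod int n)"
  have j: "j = q * int n + int r" and r: "r < n"
    using assms(2) by (auto simp: q_def r_def nat_less_iff)
  have "height n I (q * int n + int (Suc r)) = height n I (q * int n + int r) + of_bool (r \<in> I)"
    using assms r by (simp only: height_eq Suc_leI less_imp_le card_Int_lessThan_Suc) simp
  then show ?thesis unfolding r_def[symmetric] by (simp add: j add.assoc add.commute[of 1])
qed

lemma height_path:
  assumes "I \<in> ksubsets k n" "0 < n"
  shows "lattice_path k n (height n I)"
proof -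
  have I: "I \<subseteq> {..<n}" "card I = k" using assms by (auto simp: ksubsets_def)
  have "height n I (j + int n) = height n I j + int k" for j
    using assms(2) I by (simp add: height_def algebra_simps)
  then show ?thesis using height_step[OF I(1) assms(2)] by (auto simp: lattice_path_def)
qed

lemma up_steps_height:
  assumes "I \<in> ksubsets k n" "0 < n"
  shows "up_steps n (height n I) = I"
  using assms height_step[of I n] by (auto simp: up_steps_def ksubsets_def)

lemma path_eq_height:
  assumes z: "lattice_path k n z" and n: "0 < n"
  shows "up_steps n z \<in> ksubsets k n" and "z j = z 0 + height n (up_steps n z) j"
proof -
  let ?U = "up_steps n z"
  have sub: "?U \<subseteq> {..<n}" by (auto simp: up_steps_def)
  have pre: "z (int r) = z 0 + int (card (?U \<inter> {..<r}))" if "r \<le> n" for r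
    using that
  proof (induction r)
    case (Suc r)
    have "z (int r) \<le> z (int r + 1)" "z (int r + 1) \<le> z (int r) + 1"
      using z unfolding lattice_path_def by blast+
    then have "z (int r + 1) = z (int r) + of_bool (r \<in> ?U)"
      using Suc.prems by (auto simp: up_steps_def)
    then show ?case using Suc by (simp add: card_Int_lessThan_Suc add.commute)
  qed simp
  have "?U \<inter> {..<n} = ?U" using sub by auto
  then have card: "card ?U = k"
    using pre[of n] z[unfolded lattice_path_def, rule_format, of 0] by simp
  then show U: "?U \<in> ksubsets k n" using sub by (auto simp: ksubsets_def)
  have r: "nat (j mod int n) < n" using n by (simp add: nat_less_iff)
  have "z j = z (int (nat (j mod int n))) + (j div int n) * int k"
    using path_mod(1)[OF z, of j] n by simp
  also have "\<dots> = z 0 + height n ?U j"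
    using pre[of "nat (j mod int n)"] r card by (simp add: height_def)
  finally show "z j = z 0 + height n ?U j" .
qed

lemma height_0: "height n I 0 = 0"
  by (simp add: height_def)

lemma mod_succ_neq:
  assumes "2 \<le> n" shows "(j + 1) mod int n \<noteq> j mod int n"
proof
  assume "(j + 1) mod int n = j mod int n"
  then have "int n dvd 1" by (simp add: mod_eq_dvd_iff)
  then show False using assms by (simp add: zdvd_not_zless)
qed

lemma cyc_pred_mod:
  assumes "c < n" "i < n"
  shows "(int i + 1) mod int n = int c \<longleftrightarrow> i = cyc_pred n c"
proof (cases "Suc i = n")
  case True
  then have "(int i + 1) mod int n = 0" by (metis add.commute mod_self of_nat_Suc)
  then show ?thesis using assms True by (auto simp: cyc_pred_def)
next
  case False
  then have "(int i + 1) mod int n = int i + 1" using assms by simp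
  then show ?thesis using assms False by (auto simp: cyc_pred_def)
qed

lemma cyc_pred_less: "c < n \<Longrightarrow> cyc_pred n c < n"
  by (auto simp: cyc_pred_def)

lemma cyc_pred_step:
  assumes z: "lattice_path k n z" and c: "c < n"
  shows "cyc_pred n c \<in> up_steps n z \<longleftrightarrow> z (int c) = z (int c - 1) + 1"
proof (cases "c = 0")
  case True
  have "int (n - 1) = 0 - 1 + 1 * int n" using c by simp
  then have "z (int (n - 1)) = z (0 - 1) + int k" "z (int (n - 1) + 1) = z 0 + int k"
    using path_period_mult[OF z, of "0 - 1" 1] path_period_mult[OF z, of 0 1] by simp_all
  then show ?thesis using True c by (auto simp: cyc_pred_def up_steps_def)
next
  case False
  then show ?thesis using c by (auto simp: cyc_pred_def up_steps_def of_nat_diff)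
qed

lemma raise_path_iff:
  assumes z: "lattice_path k n z" and n: "2 \<le> n" and c: "c < n"
  shows "lattice_path k n (raise n c z) \<longleftrightarrow> c \<in> up_steps n z \<and> cyc_pred n c \<notin> up_steps n z"
    (is "?L \<longleftrightarrow> ?R")
proof -
  have zs: "z j \<le> z (j + 1)" "z (j + 1) \<le> z j + 1" for j
    using z unfolding lattice_path_def by blast+
  have R: "?R \<longleftrightarrow> z (int c + 1) = z (int c) + 1 \<and> z (int c) = z (int c - 1)"
    using cyc_pred_step[OF z c] zs[of "int c - 1"] c by (auto simp: up_steps_def)
  have cm: "int c mod int n = int c" using c by simp
  show ?thesis
  proof
    assume L: ?L
    have "raise n c z (int c) \<le> raise n c z (int c + 1)"
      "raise n c z (int c - 1 + 1) \<le> raise n c z (int c - 1) + 1"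
      using L unfolding lattice_path_def by blast+
    moreover have "(int c + 1) mod int n \<noteq> int c" "(int c - 1) mod int n \<noteq> int c"
      using mod_succ_neq[OF n, of "int c"] mod_succ_neq[OF n, of "int c - 1"] cm by auto
    ultimately show ?R
      unfolding R using zs[of "int c"] zs[of "int c - 1"] cm by (auto simp: raise_def)
  next
    assume ?R
    then have up: "z (int c + 1) = z (int c) + 1" and flat: "z (int c) = z (int c - 1)"
      unfolding R by auto
    have up': "z (j + 1) = z j + 1" if "j mod int n = int c" for j
      using path_mod[OF z, of j] that up by simp
    have flat': "z (j + 1) = z j" if "(j + 1) mod int n = int c" for j
      using path_mod[OF z, of "j + 1"] that flat by simp
    have "raise n c z (j + int n) = raise n c z j + int k" for j
      using z by (simp add: raise_def lattice_path_def)
    moreover have "raise n c z j \<le> raise n c z (j + 1) \<and> raise n c z (j + 1) \<le> raise n c z j + 1" for j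
      using mod_succ_neq[OF n, of j] zs[of j] up'[of j] flat'[of j] by (auto simp: raise_def)
    ultimately show ?L unfolding lattice_path_def by blast
  qed
qed

lemma up_steps_raise:
  assumes z: "lattice_path k n z" and n: "2 \<le> n" and c: "c < n"
    and r: "lattice_path k n (raise n c z)"
  shows "up_steps n (raise n c z) = insert (cyc_pred n c) (up_steps n z - {c})"
proof -
  have R: "c \<in> up_steps n z" "cyc_pred n c \<notin> up_steps n z"
    using raise_path_iff[OF z n c] r by auto
  have zs: "z j \<le> z (j + 1)" "z (j + 1) \<le> z j + 1" for j
    using z unfolding lattice_path_def by blast+
  have "i \<in> up_steps n (raise n c z) \<longleftrightarrow> i \<in> insert (cyc_pred n c) (up_steps n z - {c})"
    if i: "i < n" for i
  proof -
    have m: "int i mod int n = int i" using i by simp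
    have "i = cyc_pred n c \<Longrightarrow> z (int i + 1) = z (int i)"
      using R(2) i zs[of "int i"] by (auto simp: up_steps_def)
    moreover have "i \<noteq> c" if "i = cyc_pred n c" using that R by auto
    moreover have "i = c \<Longrightarrow> z (int i + 1) = z (int i) + 1" using R(1) by (auto simp: up_steps_def)
    ultimately show ?thesis
      using i m cyc_pred_mod[OF c i] by (auto simp: up_steps_def raise_def)
  qed
  moreover have "i < n" if "i \<in> up_steps n (raise n c z) \<or> i \<in> insert (cyc_pred n c) (up_steps n z - {c})" for i
    using that cyc_pred_less[OF c] by (auto simp: up_steps_def)
  ultimately show ?thesis by blast
qed

lemma raise_commute: "raise n c (raise n d z) = raise n d (raise n c z)"
  by (auto simp: raise_def)

lemma raise_shift: "raise n c (\<lambda>j. z j + m) = (\<lambda>j. raise n c z j + m)"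
  by (auto simp: raise_def)

lemma raise_of_nat: "i < n \<Longrightarrow> raise n c z (int i) = z (int i) + of_bool (i = c)"
  by (auto simp: raise_def)

lemma le_raise: "z \<le> raise n c z"
  by (auto simp: raise_def le_fun_def)

lemma raise_leI:
  assumes "lattice_path k n z" "lattice_path k n w" "z \<le> w" "0 < n" "z (int c) < w (int c)"
  shows "raise n c z \<le> w"
proof (rule le_funI)
  fix j
  have "z j < w j" if "j mod int n = int c"
    using path_mod(1)[OF assms(1), of j] path_mod(1)[OF assms(2), of j] assms(5) that by simp
  moreover have "z j \<le> w j" using assms(3) by (simp add: le_funD)
  ultimately show "raise n c z j \<le> w j" by (auto simp: raise_def)
qed

lemma area_raise: "c < n \<Longrightarrow> area n (raise n c z) = area n z + 1"
  by (simp add: area_def raise_of_nat sum.distrib of_bool_def)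

lemma area_mono: "z \<le> w \<Longrightarrow> area n z \<le> area n w"
  by (auto simp: area_def le_fun_def intro: sum_mono)

lemma area_strict_mono:
  assumes "lattice_path k n z" "lattice_path k n w" "0 < n" "z \<le> w" "z \<noteq> w"
  shows "area n z < area n w"
proof -
  have "\<exists>i<n. z (int i) < w (int i)"
  proof (rule ccontr)
    assume "\<not> (\<exists>i<n. z (int i) < w (int i))"
    then have "w \<le> z" using assms by (intro path_leI[of k n w z]) (auto simp flip: not_less)
    then show False using assms by auto
  qed
  then show ?thesis
    unfolding area_def using assms(4) by (intro sum_strict_mono_ex1) (auto simp: le_fun_def)
qed

text \<open>
  The places where \<open>r\<close> lies strictly below \<open>J\<close> are closed under moving right as long as \<open>r\<close> is
  flat, and closed under moving left as long as \<open>r\<close> rises. Since \<open>r\<close> is neither flat nor rising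
  over a whole period, some such place is a local corner of \<open>r\<close>, where \<open>r\<close> can be raised.
\<close>

lemma exists_raise_below:
  assumes r: "lattice_path k n r" and J: "lattice_path k n J" and "1 \<le> k" "k < n"
    and le: "r \<le> J" and ne: "r \<noteq> J"
  obtains d where "d < n" "lattice_path k n (raise n d r)" "r (int d) < J (int d)"
proof -
  have rs: "r j \<le> r (j + 1)" "r (j + 1) \<le> r j + 1" and rp: "r (j + int n) = r j + int k"
    and Js: "J j \<le> J (j + 1)" "J (j + 1) \<le> J j + 1" for j
    using r J unfolding lattice_path_def by blast+
  obtain j0 where j0: "r j0 < J j0"
    using le ne by (metis antisym le_funI linorder_not_less)
  \<comment> \<open>moving right: otherwise \<open>r\<close> would be flat over a whole period, against \<open>1 \<le> k\<close>\<close>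
  have "\<exists>j. r j < J j \<and> r (j + 1) = r j + 1"
  proof (rule ccontr)
    assume no: "\<nexists>j. r j < J j \<and> r (j + 1) = r j + 1"
    have "r (j0 + int m) < J (j0 + int m) \<and> r (j0 + int m) = r j0" for m
    proof (induction m)
      case (Suc m)
      have "r (j0 + int m + 1) = r (j0 + int m)"
        using no Suc rs[of "j0 + int m"] by (metis add1_zle_eq antisym linorder_not_less)
      then show ?case using Suc Js(1)[of "j0 + int m"] by (simp add: add.assoc add.commute[of 1])
    qed (simp add: j0)
    then show False using rp[of j0] \<open>1 \<le> k\<close> by (metis add_cancel_right_right not_one_le_zero of_nat_eq_0_iff)
  qed
  then obtain j1 where j1: "r j1 < J j1" "r (j1 + 1) = r j1 + 1" by blast
  \<comment> \<open>moving left: otherwise \<open>r\<close> would rise over a whole period, against \<open>k < n\<close>\<close>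
  have "\<exists>j. r j < J j \<and> r (j + 1) = r j + 1 \<and> r (j - 1) = r j"
  proof (rule ccontr)
    assume no: "\<nexists>j. r j < J j \<and> r (j + 1) = r j + 1 \<and> r (j - 1) = r j"
    have "r (j1 - int m) < J (j1 - int m) \<and> r (j1 - int m + 1) = r (j1 - int m) + 1 \<and>
      r (j1 - int m) = r j1 - int m" for m
    proof (induction m)
      case (Suc m)
      let ?j = "j1 - int m"
      have e: "j1 - int (Suc m) = ?j - 1" "j1 - int (Suc m) + 1 = ?j" by simp_all
      have "r (?j - 1) \<noteq> r ?j" using no Suc by blast
      then have "r (?j - 1) = r ?j - 1" using rs[of "?j - 1"] by simp
      moreover have "J ?j \<le> J (?j - 1) + 1" using Js(2)[of "?j - 1"] by simp
      ultimately show ?case unfolding e using Suc by simp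
    qed (simp add: j1)
    from this[of n] show False using rp[of "j1 - int n"] \<open>k < n\<close> by simp
  qed
  then obtain j where j: "r j < J j" "r (j + 1) = r j + 1" "r (j - 1) = r j" by blast
  define d where "d = nat (j mod int n)"
  have d: "int d = j mod int n" "d < n" using \<open>k < n\<close> by (auto simp: d_def nat_less_iff)
  have at: "r (int d) < J (int d)" "r (int d + 1) = r (int d) + 1" "r (int d - 1) = r (int d)"
    using j path_mod[OF r, of j] path_mod[OF J, of j] d by auto
  have "d \<in> up_steps n r" "cyc_pred n d \<notin> up_steps n r"
    using at d cyc_pred_step[OF r d(2)] by (auto simp: up_steps_def)
  then have "lattice_path k n (raise n d r)"
    using raise_path_iff[OF r _ d(2)] assms by simp
  then show thesis using that d at by blast
qed

lemma set_splice: "set (splice xs ys) = set xs \<union> set ys"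
  by (induction xs ys rule: splice.induct) auto

text \<open>
  Interlacing in terms of counting functions: reading the merged sequence from the left, the
  number of entries of \<open>as\<close> seen so far exceeds that of \<open>bs\<close> by 0 or 1. The lengths may differ by
  one because removing the first entry exchanges the roles of the two lists.
\<close>

lemma sorted_splice_iff:
  fixes as bs :: "nat list"
  assumes "sorted_wrt (<) as" "sorted_wrt (<) bs" "set as \<inter> set bs = {}"
    "length bs \<le> length as" "length as \<le> Suc (length bs)"
  shows "sorted_wrt (<) (splice as bs) \<longleftrightarrow>
    (\<forall>j. length (filter (\<lambda>x. x < j) bs) \<le> length (filter (\<lambda>x. x < j) as) \<and>
         length (filter (\<lambda>x. x < j) as) \<le> Suc (length (filter (\<lambda>x. x < j) bs)))"
  using assms
proof (induction as bs rule: splice.induct)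
  case (2 a as bs)
  let ?c = "\<lambda>xs j. length (filter (\<lambda>x. x < j) xs)"
  have IH: "sorted_wrt (<) (splice bs as) \<longleftrightarrow> (\<forall>j. ?c as j \<le> ?c bs j \<and> ?c bs j \<le> Suc (?c as j))"
    using 2 by auto
  have gt: "a < x" if "x \<in> set as" for x using 2 that by auto
  have below: "?c as j = 0" if "j \<le> a" for j using that gt by (fastforce simp: filter_empty_conv)
  show ?case
  proof (cases "\<forall>b\<in>set bs. a < b")
    case True
    then have "?c bs j = 0" if "j \<le> a" for j using that by (fastforce simp: filter_empty_conv)
    then have "(?c as j \<le> ?c bs j \<and> ?c bs j \<le> Suc (?c as j)) \<longleftrightarrow>
        (?c bs j \<le> ?c (a # as) j \<and> ?c (a # as) j \<le> Suc (?c bs j))" for j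
      using below[of j] by (cases "j \<le> a") auto
    moreover have "sorted_wrt (<) (splice (a # as) bs) \<longleftrightarrow> sorted_wrt (<) (splice bs as)"
      using True gt by (auto simp: set_splice)
    ultimately show ?thesis using IH by simp
  next
    case False
    then obtain b where b: "b \<in> set bs" "b < a" using 2 by fastforce
    have "?c (a # as) (Suc b) = 0" using below[of "Suc b"] b by auto
    moreover have "?c bs (Suc b) \<noteq> 0" using b by (auto simp: filter_empty_conv)
    ultimately have "\<not> (?c bs (Suc b) \<le> ?c (a # as) (Suc b))" by simp
    moreover have "\<not> (\<forall>x\<in>set (splice bs as). a < x)"
      using b by (meson UnI1 less_asym set_splice[THEN equalityD2, THEN subsetD])
    then have "\<not> sorted_wrt (<) (splice (a # as) bs)" by simp
    ultimately show ?thesis by blast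
  qed
qed simp

text \<open>
  Elements common to \<open>I\<close> and \<open>J\<close> cancel in the difference of the two heights, so the counting
  criterion for interlacing says that the heights differ by 0 or 1 everywhere, with a constant sign.
\<close>

lemma sorted_pair_iff_height:
  assumes I: "I \<in> ksubsets k n" and J: "J \<in> ksubsets k n" and n: "0 < n"
  shows "sorted_pair I J \<longleftrightarrow>
    (height n J \<le> height n I \<and> height n I \<le> (\<lambda>j. height n J j + 1)) \<or>
    (height n I \<le> height n J \<and> height n J \<le> (\<lambda>j. height n I j + 1))"
proof -
  have sub: "I \<subseteq> {..<n}" "J \<subseteq> {..<n}" "card I = k" "card J = k"
    using I J by (auto simp: ksubsets_def)
  then have fin: "finite I" "finite J" using finite_subset by auto
  define c where "c A j = int (length (filter (\<lambda>x. x < j) (sorted_list_of_set A)))" for A and j :: nat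
  have c: "c A j = int (card (A \<inter> {..<j}))" if "finite A" for A j
  proof -
    have "{x. x < j} \<inter> A = A \<inter> {..<j}" by auto
    then show ?thesis using that by (simp add: c_def distinct_length_filter)
  qed
  have split: "int (card (A \<inter> {..<j})) = c (A - B) j + int (card (A \<inter> B \<inter> {..<j}))"
    if "finite A" for A B j
  proof -
    have "A \<inter> {..<j} = ((A - B) \<inter> {..<j}) \<union> (A \<inter> B \<inter> {..<j})" by auto
    moreover have "card \<dots> = card ((A - B) \<inter> {..<j}) + card (A \<inter> B \<inter> {..<j})"
      using that by (intro card_Un_disjoint) auto
    ultimately show ?thesis using c[of "A - B"] that by simp
  qed
  have diff: "c (I - J) j - c (J - I) j = int (card (I \<inter> {..<j})) - int (card (J \<inter> {..<j}))" for j
    using split[of I j J] split[of J j I] fin by (simp add: Int_commute)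
  have hdiff: "(\<forall>j. P (c (I - J) j - c (J - I) j)) \<longleftrightarrow> (\<forall>j. P (height n I j - height n J j))" for P
  proof safe
    fix j assume "\<forall>j. P (c (I - J) j - c (J - I) j)"
    then show "P (height n I j - height n J j)"
      unfolding diff using sub by (simp add: height_def)
  next
    fix j assume P: "\<forall>j. P (height n I j - height n J j)"
    show "P (c (I - J) j - c (J - I) j)"
    proof (cases "j \<le> n")
      case True
      then show ?thesis unfolding diff using P[rule_format, of "int j"] sub n by (simp add: height_of_nat)
    next
      case False
      then have "I \<inter> {..<j} = I" "J \<inter> {..<j} = J" using sub by auto
      then show ?thesis unfolding diff using P[rule_format, of 0] sub by (simp add: height_0)
    qed
  qed
  let ?a = "sorted_list_of_set (I - J)" and ?b = "sorted_list_of_set (J - I)"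
  have "card (I - J) = card (J - I)"
    using sub fin by (metis card_Diff_subset_Int finite_Int Int_commute)
  then have len: "length ?a = length ?b" by simp
  have s: "sorted_wrt (<) ?a" "sorted_wrt (<) ?b" "set ?a \<inter> set ?b = {}" "set ?b \<inter> set ?a = {}"
    using fin by auto
  have "sorted_pair I J \<longleftrightarrow> (\<forall>j. 0 \<le> c (I - J) j - c (J - I) j \<and> c (I - J) j - c (J - I) j \<le> 1) \<or>
      (\<forall>j. 0 \<le> - (c (I - J) j - c (J - I) j) \<and> - (c (I - J) j - c (J - I) j) \<le> 1)"
    unfolding sorted_pair_def Let_def sorted_splice_iff[OF s(1,2,3) eq_imp_le[OF len[symmetric]] le_SucI[OF eq_imp_le[OF len]]]
      sorted_splice_iff[OF s(2,1,4) eq_imp_le[OF len] le_SucI[OF eq_imp_le[OF len[symmetric]]]] c_def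
    by (intro arg_cong2[where f = "(\<or>)"] all_cong1) auto
  also have "\<dots> \<longleftrightarrow> (\<forall>j. 0 \<le> height n I j - height n J j \<and> height n I j - height n J j \<le> 1) \<or>
      (\<forall>j. 0 \<le> - (height n I j - height n J j) \<and> - (height n I j - height n J j) \<le> 1)"
    using hdiff[of "\<lambda>t. 0 \<le> t \<and> t \<le> 1"] hdiff[of "\<lambda>t. 0 \<le> - t \<and> - t \<le> 1"] by simp
  finally show ?thesis by (auto simp: le_fun_def algebra_simps)
qed

section \<open>Strict supermodularity on lattice paths\<close>

text \<open>
  The inequalities that the three-term relation implies for logarithms of positive Pluecker
  coordinates: among the three ways to split \<open>a < b < c < d\<close> into two pairs, the interlacing one
  has the strictly largest value.
\<close>

definition three_term_strict :: "nat \<Rightarrow> nat \<Rightarrow> (nat set \<Rightarrow> real) \<Rightarrow> bool" where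
  "three_term_strict k n F \<longleftrightarrow>
     (\<forall>R a b c d. R \<subseteq> {..<n} \<and> card R + 2 = k \<and> a < b \<and> b < c \<and> c < d \<and> d < n \<and>
        {a, b, c, d} \<inter> R = {} \<longrightarrow>
        F (insert a (insert b R)) + F (insert c (insert d R))
          < F (insert a (insert c R)) + F (insert b (insert d R)) \<and>
        F (insert a (insert d R)) + F (insert b (insert c R))
          < F (insert a (insert c R)) + F (insert b (insert d R)))"

text \<open>
  The four sets around a square of raises differ only in four elements, the two raised ones and
  their cyclic predecessors. Splitting these four into the pairs that occur at the bottom and the
  top of the square is the interlacing splitting, so the square inequality is one of the three-term
  inequalities.
\<close>

lemma raise_square_ordered:
  assumes F: "three_term_strict k n F" and z: "lattice_path k n z" and n: "2 \<le> n"
    and cd: "c < d" "d < n"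
    and c: "lattice_path k n (raise n c z)" and d: "lattice_path k n (raise n d z)"
  shows "lattice_path k n (raise n d (raise n c z))"
    and "F (up_steps n (raise n c z)) + F (up_steps n (raise n d z))
       < F (up_steps n z) + F (up_steps n (raise n d (raise n c z)))"
proof -
  let ?U = "up_steps n z" and ?pc = "cyc_pred n c" and ?pd = "cyc_pred n d"
  have cn: "c < n" using cd by simp
  have in_U: "c \<in> ?U" "?pc \<notin> ?U" "d \<in> ?U" "?pd \<notin> ?U"
    using raise_path_iff[OF z n cn] raise_path_iff[OF z n cd(2)] c d by auto
  then have neq: "?pc \<noteq> d" "?pd \<noteq> c" by auto
  have pd: "?pd = d - 1" "c < ?pd" using neq cd by (auto simp: cyc_pred_def)
  have upc: "up_steps n (raise n c z) = insert ?pc (?U - {c})"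
    using up_steps_raise[OF z n cn c] .
  have upd: "up_steps n (raise n d z) = insert ?pd (?U - {d})"
    using up_steps_raise[OF z n cd(2) d] .
  have pcd: "?pc \<noteq> ?pd" using pd cd by (auto simp: cyc_pred_def)
  show path: "lattice_path k n (raise n d (raise n c z))"
    using raise_path_iff[OF c n cd(2)] in_U neq pcd cd unfolding upc by auto
  have upcd: "up_steps n (raise n d (raise n c z)) = insert ?pd (insert ?pc (?U - {c}) - {d})"
    using up_steps_raise[OF c n cd(2) path] unfolding upc .
  define R where "R = ?U - {c, d}"
  have U: "?U \<in> ksubsets k n" using path_eq_height(1)[OF z] n by simp
  then have "?U \<subseteq> {..<n}" "card ?U = k" by (auto simp: ksubsets_def)
  moreover from this have "finite ?U" using finite_subset by auto
  ultimately have R: "R \<subseteq> {..<n}" "card R + 2 = k"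
    using in_U cd card_mono[of ?U "{c, d}"] by (auto simp: R_def card_Diff_subset)
  have sets: "?U = insert c (insert d R)"
    "up_steps n (raise n c z) = insert ?pc (insert d R)"
    "up_steps n (raise n d z) = insert c (insert ?pd R)"
    "up_steps n (raise n d (raise n c z)) = insert ?pc (insert ?pd R)"
    using in_U cd neq pcd unfolding upc upd upcd R_def by auto
  have disj: "{c, d, ?pc, ?pd} \<inter> R = {}" using in_U by (auto simp: R_def)
  have T: "F (insert a (insert b R)) + F (insert c (insert d R))
          < F (insert a (insert c R)) + F (insert b (insert d R)) \<and>
        F (insert a (insert d R)) + F (insert b (insert c R))
          < F (insert a (insert c R)) + F (insert b (insert d R))"
    if "a < b" "b < c" "c < d" "d < n" "{a, b, c, d} \<inter> R = {}" for a b c d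
    using F R that unfolding three_term_strict_def by blast
  show "F (up_steps n (raise n c z)) + F (up_steps n (raise n d z))
       < F (up_steps n z) + F (up_steps n (raise n d (raise n c z)))"
  \<comment> \<open>for \<open>c = 0\<close> the predecessor wraps around, and the order is \<open>c < ?pd < d < ?pc\<close> instead of
    \<open>?pc < c < ?pd < d\<close>\<close>
  proof (cases "c = 0")
    case True
    then have "?pc = n - 1" by (simp add: cyc_pred_def)
    then have "d < ?pc" "?pc < n" using neq cd by auto
    then show ?thesis
      unfolding sets using T[of c ?pd d ?pc] disj pd cd
      by (auto simp: insert_commute add.commute)
  next
    case False
    then have "?pc < c" by (simp add: cyc_pred_def)
    then show ?thesis
      unfolding sets using T[of ?pc c ?pd d] disj pd cd
      by (auto simp: insert_commute add.commute)
  qed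
qed

lemma raise_square:
  assumes F: "three_term_strict k n F" and z: "lattice_path k n z" and n: "2 \<le> n"
    and cd: "c \<noteq> d" "c < n" "d < n"
    and c: "lattice_path k n (raise n c z)" and d: "lattice_path k n (raise n d z)"
  shows "lattice_path k n (raise n d (raise n c z))"
    and "F (up_steps n (raise n c z)) + F (up_steps n (raise n d z))
       < F (up_steps n z) + F (up_steps n (raise n d (raise n c z)))"
proof -
  have "lattice_path k n (raise n d (raise n c z)) \<and>
    F (up_steps n (raise n c z)) + F (up_steps n (raise n d z))
       < F (up_steps n z) + F (up_steps n (raise n d (raise n c z)))"
  proof (cases "c < d")
    case True
    then show ?thesis using raise_square_ordered[OF F z n _ cd(3) c d] by simp
  next
    case False
    then have "d < c" using cd by simp
    then show ?thesis
      using raise_square_ordered[OF F z n _ cd(2) d c] raise_commute[of n c d z] by (simp add: add.commute)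
  qed
  then show "lattice_path k n (raise n d (raise n c z))"
    "F (up_steps n (raise n c z)) + F (up_steps n (raise n d z))
       < F (up_steps n z) + F (up_steps n (raise n d (raise n c z)))" by auto
qed

text \<open>
  A path of single raises from \<open>q\<close> up to \<open>J\<close> never touches the class of \<open>c\<close>, because \<open>q\<close> and \<open>J\<close>
  agree there. Raising at \<open>c\<close> along the whole path gives a ladder of squares, and the square
  inequalities telescope.
\<close>

lemma raise_exchange:
  assumes F: "three_term_strict k n F" and k: "1 \<le> k" "k < n"
    and J: "lattice_path k n J" and q: "lattice_path k n q" and le: "q \<le> J"
    and c: "c < n" "lattice_path k n (raise n c q)" "q (int c) = J (int c)"
  shows "lattice_path k n (raise n c J)"
    and "q \<noteq> J \<Longrightarrow> F (up_steps n J) + F (up_steps n (raise n c q))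
           < F (up_steps n q) + F (up_steps n (raise n c J))"
proof -
  have "lattice_path k n (raise n c J) \<and>
    (q \<noteq> J \<longrightarrow> F (up_steps n J) + F (up_steps n (raise n c q))
           < F (up_steps n q) + F (up_steps n (raise n c J)))"
    using q le c(2,3)
  proof (induction "nat (area n J - area n q)" arbitrary: q rule: less_induct)
    case less
    note q = less.prems
    show ?case
    proof (cases "q = J")
      case False
      obtain d where d: "d < n" "lattice_path k n (raise n d q)" "q (int d) < J (int d)"
        using exists_raise_below[OF q(1) J k q(2) False] .
      have cd: "c \<noteq> d" using d q(4) by auto
      have n: "2 \<le> n" using k by simp
      note sq = raise_square[OF F q(1) n cd c(1) d(1) q(3) d(2)]
      have le': "raise n d q \<le> J" using raise_leI[OF q(1) J q(2) _ d(3)] k by simp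
      have val: "raise n d q (int c) = J (int c)"
        using q(4) cd c(1) by (simp add: raise_of_nat)
      have "area n (raise n d q) \<le> area n J" using le' by (rule area_mono)
      then have "nat (area n J - area n (raise n d q)) < nat (area n J - area n q)"
        using area_raise[OF d(1), of q] by simp
      from less.hyps[OF this d(2) le' _ val] sq
      have IH: "lattice_path k n (raise n c J)"
        "raise n d q \<noteq> J \<Longrightarrow> F (up_steps n J) + F (up_steps n (raise n c (raise n d q)))
           < F (up_steps n (raise n d q)) + F (up_steps n (raise n c J))"
        by (simp_all add: raise_commute)
      then show ?thesis
        using sq(2) by (cases "raise n d q = J") (auto simp: raise_commute)
    qed (use q in auto)
  qed
  then show "lattice_path k n (raise n c J)" and "q \<noteq> J \<Longrightarrow> F (up_steps n J) + F (up_steps n (raise n c q))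
           < F (up_steps n q) + F (up_steps n (raise n c J))" by auto
qed

section \<open>Maximal sorted collections as maximal chains of paths\<close>

locale maximal_sorted =
  fixes k n :: nat and S :: "nat set set"
  assumes k_pos: "1 \<le> k" and k_less: "k < n" and maximal: "maximal_sorted_subset k n S"
begin

lemma n_bounds: "0 < n" "2 \<le> n" using k_pos k_less by auto

lemma S_ksubsets: "I \<in> S \<Longrightarrow> I \<in> ksubsets k n"
  and S_sorted: "I \<in> S \<Longrightarrow> J \<in> S \<Longrightarrow> sorted_pair I J"
  using maximal by (auto simp: maximal_sorted_subset_def sorted_subset_def)

lemma S_absorb:
  assumes "J \<in> ksubsets k n" "\<And>I. I \<in> S \<Longrightarrow> sorted_pair I J"
  shows "J \<in> S"
proof -
  have sym: "sorted_pair J I" if "I \<in> S" for I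
    using assms that S_ksubsets sorted_pair_iff_height[OF _ _ n_bounds(1)] by blast
  have "sorted_pair J J" by (simp add: sorted_pair_def)
  then have "sorted_subset k n (insert J S)"
    using assms sym S_ksubsets S_sorted unfolding sorted_subset_def by auto
  then show ?thesis using maximal unfolding maximal_sorted_subset_def by blast
qed

lemma S_nonempty: "S \<noteq> {}"
proof
  assume "S = {}"
  moreover have "{..<k} \<in> ksubsets k n" using k_less by (auto simp: ksubsets_def)
  ultimately show False using S_absorb by blast
qed

text \<open>
  The paths whose set of up-steps lies in \<open>S\<close>, at all heights. Sortedness and maximality of \<open>S\<close>
  become the statement that \<open>lifts\<close> is a maximal chain of paths that is invariant under shifts.
\<close>

definition lifts :: "(int \<Rightarrow> int) set" where
  "lifts = {z. lattice_path k n z \<and> up_steps n z \<in> S}"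

lemma lifts_path: "q \<in> lifts \<Longrightarrow> lattice_path k n q"
  by (simp add: lifts_def)

lemma height_lifts: "I \<in> S \<Longrightarrow> height n I \<in> lifts"
  using height_path[OF S_ksubsets n_bounds(1)] up_steps_height[OF S_ksubsets n_bounds(1)]
  by (simp add: lifts_def)

lemma lifts_shift: "q \<in> lifts \<Longrightarrow> (\<lambda>j. q j + m) \<in> lifts"
  by (simp add: lifts_def path_shift up_steps_shift)

lemma lifts_chain:
  assumes "z \<in> lifts" "w \<in> lifts"
  shows "z \<le> w \<or> w \<le> z"
proof -
  let ?I = "height n (up_steps n z)" and ?J = "height n (up_steps n w)"
  have z: "z = (\<lambda>j. z 0 + ?I j)" and w: "w = (\<lambda>j. w 0 + ?J j)"
    by (rule ext, rule path_eq_height(2)[OF lifts_path n_bounds(1)], rule assms)+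
  have "sorted_pair (up_steps n z) (up_steps n w)"
    using assms S_sorted by (simp add: lifts_def)
  then have s: "(?J \<le> ?I \<and> ?I \<le> (\<lambda>j. ?J j + 1)) \<or> (?I \<le> ?J \<and> ?J \<le> (\<lambda>j. ?I j + 1))"
    using sorted_pair_iff_height[OF S_ksubsets S_ksubsets n_bounds(1)] assms by (simp add: lifts_def)
  have close: "?I j \<le> ?J j + 1" "?J j \<le> ?I j + 1" for j
    using s by (auto simp: le_fun_def dest!: spec[of _ j])
  have "(\<lambda>j. z 0 + ?I j) \<le> (\<lambda>j. w 0 + ?J j) \<or> (\<lambda>j. w 0 + ?J j) \<le> (\<lambda>j. z 0 + ?I j)"
  proof (cases "z 0" "w 0" rule: linorder_cases)
    case less
    then have "z 0 + ?I j \<le> w 0 + ?J j" for j using close(1)[of j] by simp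
    then show ?thesis by (simp add: le_fun_def)
  next
    case equal
    then show ?thesis using s by (auto simp: le_fun_def)
  next
    case greater
    then have "w 0 + ?J j \<le> z 0 + ?I j" for j using close(2)[of j] by simp
    then show ?thesis by (simp add: le_fun_def)
  qed
  then show ?thesis unfolding z[symmetric] w[symmetric] .
qed

text \<open>
  Comparability of \<open>r\<close> with the lifts of \<open>I\<close> just above and just below the starting point of \<open>r\<close>
  forces the heights of the two sets to differ by at most 1, and comparability with the lift through
  that point gives the difference a constant sign. So the up-steps of \<open>r\<close> are sorted with every
  member of \<open>S\<close>, and maximality applies.
\<close>

lemma lifts_absorb:
  assumes r: "lattice_path k n r" and cmp: "\<And>q. q \<in> lifts \<Longrightarrow> q \<le> r \<or> r \<le> q"
  shows "r \<in> lifts"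
proof -
  let ?U = "up_steps n r"
  have U: "?U \<in> ksubsets k n" and req: "r j = r 0 + height n ?U j" for j
    by (rule path_eq_height[OF r n_bounds(1)])+
  have "sorted_pair I ?U" if I: "I \<in> S" for I
  proof -
    have c: "(\<forall>j. m + height n I j \<le> height n ?U j) \<or> (\<forall>j. height n ?U j \<le> m + height n I j)" for m
    proof -
      have "(\<lambda>j. height n I j + (r 0 + m)) \<le> r \<or> r \<le> (\<lambda>j. height n I j + (r 0 + m))"
        by (intro cmp lifts_shift height_lifts I)
      then have "(\<forall>j. height n I j + (r 0 + m) \<le> r j) \<or> (\<forall>j. r j \<le> height n I j + (r 0 + m))"
        by (simp add: le_fun_def)
      moreover have "height n I j + (r 0 + m) \<le> r j \<longleftrightarrow> m + height n I j \<le> height n ?U j"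
        "r j \<le> height n I j + (r 0 + m) \<longleftrightarrow> height n ?U j \<le> m + height n I j" for j
        using req[of j] by linarith+
      ultimately show ?thesis by simp
    qed
    \<comment> \<open>both fail at \<open>j = 0\<close>, where the two heights vanish\<close>
    have "\<not> (\<forall>j. 1 + height n I j \<le> height n ?U j)" "\<not> (\<forall>j. height n ?U j \<le> -1 + height n I j)"
      using height_0 by (auto intro!: exI[of _ 0])
    then have b: "\<forall>j. height n ?U j \<le> 1 + height n I j" "\<forall>j. -1 + height n I j \<le> height n ?U j"
      using c[of 1] c[of "-1"] by auto
    then have "height n I j \<le> height n ?U j + 1" for j by (metis add.commute add_uminus_conv_diff diff_le_eq)
    then show ?thesis
      using b c[of 0] by (auto simp: sorted_pair_iff_height[OF S_ksubsets[OF I] U n_bounds(1)] le_fun_def add.commute)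
  qed
  then show ?thesis using S_absorb[OF U] r by (simp add: lifts_def)
qed

text \<open>
  A single raise of \<open>q\<close> that stays below the next lift is comparable with all lifts, hence is
  itself a lift: the chain has no gaps.
\<close>

lemma exists_successor:
  assumes q: "q \<in> lifts"
  obtains c where "c < n" "raise n c q \<in> lifts"
proof -
  define P where "P p \<longleftrightarrow> p \<in> lifts \<and> q \<le> p \<and> p \<noteq> q" for p
  have "P (\<lambda>j. q j + 1)" using q lifts_shift by (auto simp: P_def le_fun_def fun_eq_iff)
  then obtain p where p: "P p" and least: "\<And>x. P x \<Longrightarrow> nat (area n p - area n q) \<le> nat (area n x - area n q)"
    using ex_has_least_nat[of P _ "\<lambda>x. nat (area n x - area n q)"] by blast
  have least': "area n p \<le> area n x" if "P x" for x
  proof -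
    have "area n q < area n p"
      using p q by (intro area_strict_mono[of k]) (auto simp: P_def lifts_path n_bounds)
    then show ?thesis using least[OF that] by simp
  qed
  obtain d where d: "d < n" "lattice_path k n (raise n d q)" "q (int d) < p (int d)"
    using exists_raise_below[OF lifts_path[OF q] _ k_pos k_less] p
    by (metis P_def lifts_path)
  have le: "raise n d q \<le> p"
    using raise_leI[of k n q p d] p q d n_bounds by (simp add: P_def lifts_path)
  have "raise n d q \<in> lifts"
  proof (rule lifts_absorb[OF d(2)])
    fix x assume x: "x \<in> lifts"
    show "x \<le> raise n d q \<or> raise n d q \<le> x"
    proof (cases "x \<le> q")
      case True
      then show ?thesis using le_raise order_trans by blast
    next
      case False
      then have "P x" using lifts_chain[OF x q] x by (auto simp: P_def)
      then have "area n p \<le> area n x" by (rule least')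
      then have "p \<le> x"
        using lifts_chain[OF x, of p] area_strict_mono[of k n x p] x p n_bounds
        by (auto simp: P_def lifts_path)
      then show ?thesis using le order_trans by blast
    qed
  qed
  then show thesis using that d by blast
qed

text \<open>
  If \<open>q\<close> and \<open>p\<close> agree at \<open>c\<close>, neither raise at \<open>c\<close> lies below the other path. As all four are in
  the chain, each path lies below the raise of the other, which forces equality away from \<open>c\<close> too.
\<close>

lemma raise_unique:
  assumes q: "q \<in> lifts" "raise n c q \<in> lifts" and p: "p \<in> lifts" "raise n c p \<in> lifts"
    and c: "c < n" "q (int c) = p (int c)"
  shows "q = p"
proof -
  have le: "y \<le> x" if x: "x \<in> lifts" "raise n c x \<in> lifts" and y: "y \<in> lifts"
    and xy: "x (int c) = y (int c)" for x y
  proof (rule path_leI[OF lifts_path[OF y] lifts_path[OF x(1)] n_bounds(1)])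
    fix i assume i: "i < n"
    have "\<not> raise n c x \<le> y"
      using c(1) xy by (auto simp: le_fun_def raise_of_nat intro!: exI[of _ "int c"])
    then have "y (int i) \<le> raise n c x (int i)" using lifts_chain[OF x(2) y] by (auto simp: le_fun_def)
    then show "y (int i) \<le> x (int i)" using i xy by (cases "i = c") (auto simp: raise_of_nat)
  qed
  show ?thesis using le[OF q p(1) c(2)] le[OF p q(1)] c(2) by simp
qed

lemma raise_unique_up_steps:
  assumes q: "q \<in> lifts" "raise n c q \<in> lifts" and p: "p \<in> lifts" "raise n c p \<in> lifts" and c: "c < n"
  shows "up_steps n q = up_steps n p" "up_steps n (raise n c q) = up_steps n (raise n c p)"
proof -
  define m where "m = p (int c) - q (int c)"
  have "(\<lambda>j. q j + m) = p"
    using q p c lifts_shift[of _ m] by (intro raise_unique[of _ c]) (auto simp: m_def raise_shift)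
  then show "up_steps n q = up_steps n p" "up_steps n (raise n c q) = up_steps n (raise n c p)"
    using up_steps_shift[of n q m] up_steps_shift[of n "raise n c q" m] raise_shift[of n c q m] by auto
qed

text \<open>
  The last lift with value \<open>m\<close> at \<open>c\<close> has a successor in the chain, and that successor can only
  differ at \<open>c\<close>. The chain does leave the level \<open>m\<close>, because shifting by 1 maps it to itself.
\<close>

lemma exists_raise_at:
  assumes c: "c < n"
  obtains q where "q \<in> lifts" "raise n c q \<in> lifts" "q (int c) = m"
proof -
  obtain I where I: "I \<in> S" using S_nonempty by blast
  define q0 where "q0 = (\<lambda>j. height n I j + (m - height n I (int c)))"
  have q0: "q0 \<in> lifts" "q0 (int c) = m" using I height_lifts lifts_shift by (auto simp: q0_def)
  define top where "top = (\<lambda>j. q0 j + 1)"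
  have top: "top \<in> lifts" "top (int c) = m + 1" using q0 lifts_shift by (auto simp: top_def)
  define P where "P q \<longleftrightarrow> q \<in> lifts \<and> q (int c) = m" for q
  obtain q where q: "P q" and least: "\<And>x. P x \<Longrightarrow> nat (area n top - area n q) \<le> nat (area n top - area n x)"
    using ex_has_least_nat[of P q0 "\<lambda>x. nat (area n top - area n x)"] q0 by (auto simp: P_def)
  obtain d where d: "d < n" "raise n d q \<in> lifts" using exists_successor q by (auto simp: P_def)
  have "d = c"
  proof (rule ccontr)
    assume "d \<noteq> c"
    then have P: "P (raise n d q)" using q d c by (simp add: P_def raise_of_nat)
    have "\<not> top \<le> q" using top q by (auto simp: P_def le_fun_def intro!: exI[of _ "int c"])
    then have "q \<le> top" "q \<noteq> top" using lifts_chain[of q top] q top by (auto simp: P_def)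
    then have "area n q < area n top"
      using q top n_bounds by (intro area_strict_mono[of k]) (auto simp: P_def lifts_path)
    then show False using least[OF P] area_raise[OF d(1), of q] by simp
  qed
  then show thesis using that q d by (auto simp: P_def)
qed

text \<open>
  The path \<open>q\<close> is the largest lift below \<open>J\<close>; its successor is not below \<open>J\<close>, and as the successor
  is a single raise at some \<open>c\<close>, the paths \<open>q\<close> and \<open>J\<close> agree at \<open>c\<close>.
\<close>

lemma exists_lift_below:
  assumes J: "lattice_path k n J"
  obtains q c where "q \<in> lifts" "q \<le> J" "c < n" "raise n c q \<in> lifts" "q (int c) = J (int c)"
proof -
  obtain I where I: "I \<in> S" using S_nonempty by blast
  define m where "m = (\<Sum>i<n. \<bar>J (int i) - height n I (int i)\<bar>)"
  define q0 where "q0 = (\<lambda>j. height n I j + - m)"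
  define P where "P q \<longleftrightarrow> q \<in> lifts \<and> q \<le> J" for q
  have q0: "q0 \<in> lifts" using I height_lifts lifts_shift unfolding q0_def by blast
  have "q0 \<le> J"
  proof (rule path_leI[OF lifts_path[OF q0] J n_bounds(1)])
    fix i assume "i < n"
    then have "\<bar>J (int i) - height n I (int i)\<bar> \<le> m"
      unfolding m_def by (intro member_le_sum) auto
    then show "q0 (int i) \<le> J (int i)" by (simp add: q0_def)
  qed
  then obtain q where q: "P q" and least: "\<And>x. P x \<Longrightarrow> nat (area n J - area n q) \<le> nat (area n J - area n x)"
    using ex_has_least_nat[of P q0 "\<lambda>x. nat (area n J - area n x)"] q0 by (auto simp: P_def)
  obtain c where c: "c < n" "raise n c q \<in> lifts" using exists_successor q by (auto simp: P_def)
  have "q (int c) = J (int c)"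
  proof (rule ccontr)
    assume "q (int c) \<noteq> J (int c)"
    then have "q (int c) < J (int c)" using q by (simp add: P_def le_fun_def order_less_le)
    then have le: "raise n c q \<le> J"
      using raise_leI[OF _ J] q n_bounds by (simp add: P_def lifts_path)
    then show False
      using least[of "raise n c q"] area_mono[OF le, of n] area_raise[OF c(1), of q] c by (simp add: P_def)
  qed
  then show thesis using that q c by (auto simp: P_def)
qed

text \<open>
  Take \<open>M\<close> outside \<open>S\<close> with the largest value and suppose that the value is nonnegative. With the
  largest lift \<open>q\<close> below the path of \<open>M\<close>, the exchange inequality reads
  \<open>G M + 0 < 0 + G M'\<close>, where \<open>M'\<close> is obtained from \<open>M\<close> by one raise. Then \<open>G M'\<close> is positive, so
  \<open>M'\<close> is outside \<open>S\<close> and beats \<open>M\<close>.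
\<close>

lemma negative_outside:
  assumes G: "three_term_strict k n G" and zero: "\<And>I. I \<in> S \<Longrightarrow> G I = 0"
    and J: "J \<in> ksubsets k n" "J \<notin> S"
  shows "G J < 0"
proof (rule ccontr)
  assume "\<not> G J < 0"
  let ?X = "ksubsets k n - S"
  have "ksubsets k n \<subseteq> Pow {..<n}" by (auto simp: ksubsets_def)
  then have "finite ?X" using finite_subset by blast
  moreover have "?X \<noteq> {}" using J by blast
  ultimately have "Max (G ` ?X) \<in> G ` ?X" and le_Max: "I \<in> ?X \<Longrightarrow> G I \<le> Max (G ` ?X)" for I
    by (auto intro: Max_in)
  then obtain M where M: "M \<in> ?X" and "Max (G ` ?X) = G M" by blast
  then have max: "G I \<le> G M" if "I \<in> ?X" for I using le_Max[OF that] by simp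
  have nonneg: "0 \<le> G M" using max[of J] J \<open>\<not> G J < 0\<close> by simp
  let ?z = "height n M"
  have z: "lattice_path k n ?z" "up_steps n ?z = M"
    using M n_bounds by (auto simp: height_path up_steps_height)
  obtain q c where q: "q \<in> lifts" "q \<le> ?z" "c < n" "raise n c q \<in> lifts" "q (int c) = ?z (int c)"
    using exists_lift_below[OF z(1)] .
  have "q \<noteq> ?z" using q(1) z M by (auto simp: lifts_def)
  note ex = raise_exchange[OF G k_pos k_less z(1) lifts_path[OF q(1)] q(2,3) lifts_path[OF q(4)] q(5)]
  have "G (up_steps n q) = 0" "G (up_steps n (raise n c q)) = 0"
    using q zero by (auto simp: lifts_def)
  then have gt: "G M < G (up_steps n (raise n c ?z))" using ex(2) \<open>q \<noteq> ?z\<close> z(2) by simp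
  have "up_steps n (raise n c ?z) \<in> ksubsets k n"
    using path_eq_height(1)[OF ex(1)] n_bounds by simp
  then show False using gt max[of "up_steps n (raise n c ?z)"] nonneg zero by force
qed

lemma sum_up_steps_raise:
  fixes x :: "nat \<Rightarrow> real"
  assumes q: "q \<in> lifts" "raise n c q \<in> lifts" and c: "c < n"
  shows "sum x (up_steps n (raise n c q)) = sum x (up_steps n q) - x c + x (cyc_pred n c)"
proof -
  note p = lifts_path[OF q(1)] lifts_path[OF q(2)]
  have "c \<in> up_steps n q" "cyc_pred n c \<notin> up_steps n q"
    using raise_path_iff[OF p(1) n_bounds(2) c] p by auto
  moreover have "finite (up_steps n q)" by (simp add: up_steps_def)
  ultimately show ?thesis
    unfolding up_steps_raise[OF p(1) n_bounds(2) c p(2)] by (simp add: sum_diff1)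
qed

text \<open>
  Along the chain each residue class is raised at one place only, up to shifts, so the change of
  \<open>F\<close> there is a well-defined number \<open>jump c\<close>, while a linear function with weights \<open>y\<close> changes by
  the difference of two neighbouring weights. Partial sums of the jumps therefore give weights whose
  linear function differs from \<open>F\<close> by a constant on \<open>S\<close>, and the constant is spread equally over the \<open>k\<close>
  elements of each set.
\<close>

lemma weights_exist:
  fixes F :: "nat set \<Rightarrow> real"
  obtains x :: "nat \<Rightarrow> real" where "\<And>I. I \<in> S \<Longrightarrow> sum x I = F I"
proof -
  define jump where "jump c = (SOME v. \<exists>q\<in>lifts. raise n c q \<in> lifts \<and>
    v = F (up_steps n (raise n c q)) - F (up_steps n q))" for c
  have jump: "jump c = F (up_steps n (raise n c q)) - F (up_steps n q)"
    if q: "q \<in> lifts" "raise n c q \<in> lifts" and c: "c < n" for c q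
    unfolding jump_def
  proof (rule some_equality)
    show "\<exists>p\<in>lifts. raise n c p \<in> lifts \<and> F (up_steps n (raise n c q)) - F (up_steps n q) =
      F (up_steps n (raise n c p)) - F (up_steps n p)"
      using q by blast
  next
    fix v assume "\<exists>p\<in>lifts. raise n c p \<in> lifts \<and>
      v = F (up_steps n (raise n c p)) - F (up_steps n p)"
    then show "v = F (up_steps n (raise n c q)) - F (up_steps n q)"
      using raise_unique_up_steps[OF q _ _ c] by metis
  qed
  define y where "y j = - (\<Sum>i\<in>{1..j}. jump i)" for j :: nat
  define G where "G I = F I - sum y I" for I
  have step: "G (up_steps n (raise n c q)) = G (up_steps n q)"
    if q: "q \<in> lifts" "raise n c q \<in> lifts" and c: "c < n" "c \<noteq> 0" for c q
  proof -
    obtain b where b: "c = Suc b" using c by (cases c) auto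
    have "y (cyc_pred n c) - y c = jump c" unfolding y_def b by (simp add: cyc_pred_def)
    then show ?thesis
      using sum_up_steps_raise[OF q c(1), of y] jump[OF q c(1)] by (simp add: G_def)
  qed
  \<comment> \<open>\<open>t\<close> is the largest lift with value 0 at 0; every other such lift climbs to \<open>t\<close> by raises at
    nonzero classes, which do not change \<open>G\<close>\<close>
  obtain t where t: "t \<in> lifts" "raise n 0 t \<in> lifts" "t (int 0) = 0"
    using exists_raise_at n_bounds by blast
  have const: "G (up_steps n q) = G (up_steps n t)" if "q \<in> lifts" "q 0 = 0" for q
    using that
  proof (induction "nat (area n t - area n q)" arbitrary: q rule: less_induct)
    case less
    obtain d where d: "d < n" "raise n d q \<in> lifts" using exists_successor less.prems by blast
    show ?case
    proof (cases "d = 0")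
      case True
      then have "q = t" using less.prems t d by (intro raise_unique[of q 0 t]) auto
      then show ?thesis by simp
    next
      case False
      let ?r = "raise n d q"
      have r0: "?r 0 = 0" using raise_of_nat[OF n_bounds(1), of d q] less.prems False by simp
      have "?r \<le> t"
      proof (rule path_leI[OF lifts_path[OF d(2)] lifts_path[OF t(1)] n_bounds(1)])
        fix i assume i: "i < n"
        have "raise n 0 t 0 = 1" using raise_of_nat[OF n_bounds(1), of 0 t] t by simp
        then have "\<not> raise n 0 t \<le> ?r" using r0 by (auto simp: le_fun_def intro!: exI[of _ 0])
        then have "?r (int i) \<le> raise n 0 t (int i)" using lifts_chain[OF d(2) t(2)] by (auto simp: le_fun_def)
        then show "?r (int i) \<le> t (int i)"
          using raise_of_nat[OF i, of 0 t] r0 t(3) by (cases "i = 0") auto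
      qed
      then have "nat (area n t - area n ?r) < nat (area n t - area n q)"
        using area_mono[of ?r t n] area_raise[OF d(1), of q] by simp
      then show ?thesis using less.hyps d r0 step[OF less.prems(1) d(2,1) False] by simp
    qed
  qed
  define g where "g = G (up_steps n t)"
  have G: "G I = g" if "I \<in> S" for I
    using const[OF height_lifts[OF that] height_0] up_steps_height[OF S_ksubsets[OF that] n_bounds(1)]
    by (simp add: g_def)
  have "sum (\<lambda>j. y j + g / real k) I = F I" if "I \<in> S" for I
  proof -
    have "card I = k" using S_ksubsets[OF that] by (simp add: ksubsets_def)
    then have "sum (\<lambda>j. y j + g / real k) I = sum y I + g" using k_pos by (simp add: sum.distrib)
    then show ?thesis using G[OF that] by (simp add: G_def)
  qed
  then show thesis by (rule that)
qed

text \<open>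
  Each class is raised somewhere in the chain, and the raise changes the sum by a difference of neighbouring weights.
\<close>

lemma constant_of_constant_sums:
  fixes w :: "nat \<Rightarrow> real"
  assumes "\<And>I J. I \<in> S \<Longrightarrow> J \<in> S \<Longrightarrow> sum w I = sum w J" and "i < n"
  shows "w i = w 0"
  using assms(2)
proof (induction i)
  case (Suc i)
  obtain q where q: "q \<in> lifts" "raise n (Suc i) q \<in> lifts"
    using exists_raise_at[OF Suc.prems] by blast
  then have "sum w (up_steps n (raise n (Suc i) q)) = sum w (up_steps n q)"
    using assms(1) by (simp add: lifts_def)
  then show ?case
    using sum_up_steps_raise[OF q Suc.prems, of w] Suc by (simp add: cyc_pred_def)
qed simp

end

section \<open>Representatives of points of the Grassmannian\<close>

lemma row_space_eq_image:
  fixes M :: "real mat"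
  assumes M: "M \<in> carrier_mat k n"
  shows "vec_space.row_space n M = (\<lambda>y. M\<^sup>T *\<^sub>v y) ` carrier_vec k"
  using M unfolding vec_space.row_space_eq[OF M] by (auto intro!: carrier_vecI)

lemma ksubsets_finite: "I \<in> ksubsets k n \<Longrightarrow> finite I"
  by (auto simp: ksubsets_def intro: finite_subset)

lemma submatrix_UNIV_eq:
  assumes "A \<in> carrier_mat k n" "I \<in> ksubsets k n"
  shows "submatrix A UNIV I = mat k k (\<lambda>(i, j). A $$ (i, pick I j))"
proof -
  have "{j. j < n \<and> j \<in> I} = I" "card I = k" using assms by (auto simp: ksubsets_def)
  then show ?thesis using assms unfolding submatrix_def by (intro eq_matI) (auto simp: pick_UNIV)
qed

lemma pick_ksubset:
  assumes "I \<in> ksubsets k n" "j < k"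
  shows "pick I j \<in> I" "pick I j < n"
  using assms pick_in_set_le[of j I] by (auto simp: ksubsets_def)

lemma plucker_mult:
  assumes Y: "Y \<in> carrier_mat k k" and A: "A \<in> carrier_mat k n" and I: "I \<in> ksubsets k n"
  shows "plucker (Y * A) I = det Y * plucker A I"
proof -
  have "submatrix (Y * A) UNIV I = Y * submatrix A UNIV I"
    unfolding submatrix_UNIV_eq[OF A I] submatrix_UNIV_eq[OF mult_carrier_mat[OF Y A] I]
    using Y A pick_ksubset[OF I] by (intro eq_matI) (auto simp: scalar_prod_def)
  moreover have "submatrix A UNIV I \<in> carrier_mat k k"
    unfolding submatrix_UNIV_eq[OF A I] by simp
  ultimately show ?thesis using det_mult[OF Y] by (simp add: plucker_def)
qed

lemma plucker_scale_columns:
  assumes A: "A \<in> carrier_mat k n" and I: "I \<in> ksubsets k n"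
  shows "plucker (mat k n (\<lambda>(i, j). t j * A $$ (i, j))) I = (\<Prod>i\<in>I. t i) * plucker A I"
proof -
  let ?B = "mat k n (\<lambda>(i, j). t j * A $$ (i, j))" and ?T = "mat_diag k (\<lambda>j. t (pick I j))"
  have sub: "submatrix A UNIV I \<in> carrier_mat k k" unfolding submatrix_UNIV_eq[OF A I] by simp
  have "submatrix ?B UNIV I = submatrix A UNIV I * ?T"
    unfolding mat_diag_mult_right[OF sub]
    unfolding submatrix_UNIV_eq[OF A I]
    using pick_ksubset[OF I] by (subst submatrix_UNIV_eq[OF _ I]) (auto intro!: eq_matI)
  moreover have "det ?T = (\<Prod>j<k. t (pick I j))"
  proof -
    have "det ?T = prod_list (diag_mat ?T)"
      by (intro det_upper_triangular[of _ k]) (auto simp: mat_diag_def upper_triangular_def)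
    also have "diag_mat ?T = map (\<lambda>j. t (pick I j)) [0..<k]"
      by (auto simp: diag_mat_def mat_diag_def)
    finally show ?thesis by (simp add: prod.distinct_set_conv_list[of "[0..<k]", symmetric] atLeast0LessThan)
  qed
  moreover have "(\<Prod>j<k. t (pick I j)) = (\<Prod>i\<in>I. t i)"
  proof -
    have m: "map (pick I) [0..<k] = sorted_list_of_set I"
      using map_pick_eq_sorted_list_of_set[OF ksubsets_finite[OF I]] I by (simp add: ksubsets_def)
    have "set (map (pick I) [0..<k]) = I" "distinct (map (pick I) [0..<k])"
      unfolding m using ksubsets_finite[OF I] by simp_all
    then have "pick I ` {..<k} = I" "inj_on (pick I) {..<k}"
      by (simp_all add: distinct_map atLeast0LessThan)
    then show ?thesis using prod.reindex[of "pick I" "{..<k}" t] by simp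
  qed
  moreover have "?T \<in> carrier_mat k k" by (rule mat_diag_dim)
  ultimately show ?thesis using det_mult[OF sub] by (simp add: plucker_def)
qed

lemma represents_change_of_basis:
  assumes A: "represents k n A U" and B: "represents k n B U"
  obtains Y where "Y \<in> carrier_mat k k" "B = Y * A"
proof -
  have Ac: "A \<in> carrier_mat k n" "B \<in> carrier_mat k n" using A B by (auto simp: represents_def)
  have "\<exists>y\<in>carrier_vec k. A\<^sup>T *\<^sub>v y = B\<^sup>T *\<^sub>v unit_vec k i" for i
  proof -
    have "B\<^sup>T *\<^sub>v unit_vec k i \<in> (\<lambda>y. A\<^sup>T *\<^sub>v y) ` carrier_vec k"
      using A B row_space_eq_image[OF Ac(1)] row_space_eq_image[OF Ac(2)] unit_vec_carrier
      by (auto simp: represents_def)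
    then show ?thesis by auto
  qed
  then obtain y where y: "y i \<in> carrier_vec k" "A\<^sup>T *\<^sub>v y i = B\<^sup>T *\<^sub>v unit_vec k i" for i by metis
  define Y where "Y = mat k k (\<lambda>(i, l). y i $ l)"
  have "B = Y * A"
  proof (rule eq_matI)
    fix i j assume "i < dim_row (Y * A)" "j < dim_col (Y * A)"
    then have ij: "i < k" "j < n" using Ac by (auto simp: Y_def)
    have "B $$ (i, j) = (B\<^sup>T *\<^sub>v unit_vec k i) $ j" using ij Ac by simp
    also have "\<dots> = (A\<^sup>T *\<^sub>v y i) $ j" using y by simp
    also have "\<dots> = (\<Sum>l<k. A $$ (l, j) * y i $ l)"
      using ij Ac y(1)[of i] by (simp add: scalar_prod_def atLeast0LessThan)
    also have "\<dots> = (Y * A) $$ (i, j)"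
      using ij Ac by (simp add: Y_def scalar_prod_def atLeast0LessThan mult.commute)
    finally show "B $$ (i, j) = (Y * A) $$ (i, j)" .
  qed (use Ac in \<open>auto simp: Y_def\<close>)
  then show thesis using that[of Y] by (simp add: Y_def)
qed

text \<open>
  Two matrices with the same row space differ by a \<open>k\<close> by \<open>k\<close> factor on the left, whose determinant
  multiplies all Pluecker coordinates. Statements about equality and order of the coordinates can thus be
  checked on any one positive representative.
\<close>

lemma positive_representatives_proportional:
  assumes kn: "k \<le> n" and A: "positively_represents k n A U" and B: "positively_represents k n B U"
  obtains c where "c > 0" "\<And>I. I \<in> ksubsets k n \<Longrightarrow> plucker B I = c * plucker A I"
proof -
  have rep: "represents k n A U" "represents k n B U"
    using A B by (auto simp: positively_represents_def)
  then have Ac: "A \<in> carrier_mat k n" by (simp add: represents_def)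
  obtain Y where Y: "Y \<in> carrier_mat k k" "B = Y * A" using represents_change_of_basis[OF rep] .
  have eq: "plucker B I = det Y * plucker A I" if "I \<in> ksubsets k n" for I
    using plucker_mult[OF Y(1) Ac that] Y(2) by simp
  have "{..<k} \<in> ksubsets k n" using kn by (auto simp: ksubsets_def)
  then have "plucker A {..<k} > 0" "det Y * plucker A {..<k} > 0"
    using A B eq by (auto simp: positively_represents_def)
  then have "det Y > 0" by (simp add: zero_less_mult_iff)
  then show thesis using that eq by blast
qed

lemma pluckers_equal_on_iff:
  assumes kn: "k \<le> n" and A: "positively_represents k n A U" and S: "S \<subseteq> ksubsets k n"
  shows "pluckers_equal_on k n S U \<longleftrightarrow> (\<forall>I\<in>S. \<forall>J\<in>S. plucker A I = plucker A J)"
proof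
  assume "pluckers_equal_on k n S U"
  then show "\<forall>I\<in>S. \<forall>J\<in>S. plucker A I = plucker A J"
    using A unfolding pluckers_equal_on_def by blast
next
  assume eq: "\<forall>I\<in>S. \<forall>J\<in>S. plucker A I = plucker A J"
  have "plucker B I = plucker B J" if B: "positively_represents k n B U" and IJ: "I \<in> S" "J \<in> S" for B I J
  proof -
    obtain c where "\<And>K. K \<in> ksubsets k n \<Longrightarrow> plucker B K = c * plucker A K"
      using positive_representatives_proportional[OF kn A B] by blast
    moreover have "plucker A I = plucker A J" "I \<in> ksubsets k n" "J \<in> ksubsets k n"
      using eq IJ S by blast+
    ultimately show ?thesis by simp
  qed
  then show "pluckers_equal_on k n S U" unfolding pluckers_equal_on_def by blast
qed

text \<open>
  A nonvanishing maximal minor gives the rows rank \<open>k\<close>.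
\<close>

lemma grassmannianI:
  assumes rep: "represents k n A U" and I: "I \<in> ksubsets k n" and nz: "plucker A I \<noteq> 0"
  shows "U \<in> grassmannian k n"
proof -
  interpret vec_space "TYPE(real)" n .
  have A: "A \<in> carrier_mat k n" and U: "U = row_space A" using rep by (auto simp: represents_def)
  have At: "A\<^sup>T \<in> carrier_mat n k" using A by simp
  have span: "U = span (set (cols A\<^sup>T))" unfolding U row_space_def using A by simp
  have cols: "set (cols A\<^sup>T) \<subseteq> carrier_vec n" using At cols_dim by blast
  have "vectorspace.dim class_ring (V\<lparr>carrier := U\<rparr>) = rank A\<^sup>T"
    unfolding rank_def span ..
  moreover have "rank A\<^sup>T = k"
  proof (rule antisym)
    show "rank A\<^sup>T \<le> k" by (rule rank_le_nc[OF At])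
    have "I \<inter> {i. i < n} = I" "card I = k" using I by (auto simp: ksubsets_def)
    then have "{i. i < n \<and> i \<in> I} = I" by blast
    then have "submatrix A\<^sup>T I UNIV = (submatrix A UNIV I)\<^sup>T"
      unfolding submatrix_UNIV_eq[OF A I] using A \<open>card I = k\<close> pick_ksubset[OF I]
      by (auto simp: submatrix_def pick_UNIV intro!: eq_matI)
    then have "det (submatrix A\<^sup>T I UNIV) \<noteq> 0"
      using nz det_transpose[of "submatrix A UNIV I" k] submatrix_UNIV_eq[OF A I]
      by (simp add: plucker_def)
    from rank_gt_minor[OF At this] show "k \<le> rank A\<^sup>T" by simp
  qed
  moreover have "VectorSpace.subspace class_ring U V"
    unfolding span by (rule span_is_subspace) (use cols in simp)
  ultimately show ?thesis by (simp add: grassmannian_def)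
qed

lemma torus_act_positively_represents:
  assumes A: "positively_represents k n A U" and t: "\<And>i. i < n \<Longrightarrow> t i > 0"
  shows "positively_represents k n (mat k n (\<lambda>(i, j). t j * A $$ (i, j))) (torus_act n t U)"
proof -
  have rep: "represents k n A U" using A by (simp add: positively_represents_def)
  then have Ac: "A \<in> carrier_mat k n" by (simp add: represents_def)
  have "(\<Prod>i\<in>I. t i) > 0" if "I \<in> ksubsets k n" for I
    using that t by (intro prod_pos) (auto simp: ksubsets_def)
  then show ?thesis
    using A represents_torus_act[OF rep] plucker_scale_columns[OF Ac]
    by (auto simp: positively_represents_def)
qed

lemma positively_represents_imp_positive_grassmannian:
  assumes "k \<le> n" "positively_represents k n A U"
  shows "U \<in> positive_grassmannian k n"
proof -
  have "{..<k} \<in> ksubsets k n" using assms(1) by (auto simp: ksubsets_def)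
  then have "U \<in> grassmannian k n"
    using assms(2) by (intro grassmannianI[of k n A U "{..<k}"]) (auto simp: positively_represents_def)
  then show ?thesis using assms(2) by (auto simp: positive_grassmannian_def positively_represents_def)
qed

text \<open>
  A linear subspace is invariant under scalar multiplication, so the torus acts through its
  quotient by the diagonal.
\<close>

lemma torus_act_homothety:
  assumes rep: "represents k n A U" and t: "\<And>i. i < n \<Longrightarrow> t i = c * s i" and c: "c \<noteq> 0"
  shows "torus_act n t U = torus_act n s U"
proof -
  have A: "A \<in> carrier_mat k n" and U: "U = (\<lambda>y. A\<^sup>T *\<^sub>v y) ` carrier_vec k"
    using rep row_space_eq_image[of A k n] by (auto simp: represents_def)
  have sc: "a \<cdot>\<^sub>v v \<in> U" if "v \<in> U" for a v
  proof -
    obtain y where y: "y \<in> carrier_vec k" "v = A\<^sup>T *\<^sub>v y" using \<open>v \<in> U\<close> unfolding U by blast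
    have eq: "a \<cdot>\<^sub>v v = A\<^sup>T *\<^sub>v (a \<cdot>\<^sub>v y)" using y mult_mat_vec[of "A\<^sup>T" n k y a] A by simp
    show ?thesis unfolding U eq using y by (intro imageI) simp
  qed
  have dim: "dim_vec v = n" if "v \<in> U" for v using that A unfolding U by auto
  have sub: "torus_act n t U \<subseteq> torus_act n s U" if "\<And>i. i < n \<Longrightarrow> t i = c * s i" for t s c
  proof
    fix u assume "u \<in> torus_act n t U"
    then obtain v where v: "v \<in> U" "u = vec n (\<lambda>i. t i * v $ i)" by (auto simp: torus_act_def)
    then have "u = vec n (\<lambda>i. s i * (c \<cdot>\<^sub>v v) $ i)" using dim[OF v(1)] that by (intro eq_vecI) auto
    then show "u \<in> torus_act n s U" unfolding torus_act_def using sc[OF v(1)] by blast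
  qed
  show ?thesis using sub[of t c s] sub[of s "1 / c" t] t c by simp
qed

text \<open>
  For \<open>k = n\<close> the Grassmannian is the single point \<open>carrier_vec n\<close>.
\<close>

lemma torus_act_full:
  assumes A: "positively_represents n n A U" and t: "\<And>i. i < n \<Longrightarrow> t i > 0"
  shows "torus_act n t U = U"
proof -
  have full: "W = carrier_vec n" if W: "positively_represents n n B W" for B W
  proof -
    have B: "B \<in> carrier_mat n n" and W': "W = (\<lambda>y. B\<^sup>T *\<^sub>v y) ` carrier_vec n"
      using W row_space_eq_image[of B n n] by (auto simp: positively_represents_def represents_def)
    have I: "{..<n} \<in> ksubsets n n" by (auto simp: ksubsets_def)
    have "pick {..<n} j = j" if "j < n" for j
    proof -
      have "map (pick {..<n}) [0..<n] = [0..<n]"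
        using map_pick_eq_sorted_list_of_set[of "{..<n}"] by (simp add: lessThan_atLeast0)
      then have "map (pick {..<n}) [0..<n] ! j = [0..<n] ! j" by simp
      then show ?thesis using that by simp
    qed
    then have "submatrix B UNIV {..<n} = B"
      unfolding submatrix_UNIV_eq[OF B I] using B by (intro eq_matI) auto
    then have "det B \<noteq> 0" using W I by (auto simp: positively_represents_def plucker_def)
    then have "det B\<^sup>T \<noteq> 0" using det_transpose[OF B] by simp
    then obtain C where C: "C \<in> carrier_mat n n" "B\<^sup>T * C = 1\<^sub>m n"
      using det_non_zero_imp_unit[of "B\<^sup>T" n "()"] B unfolding Units_def ring_mat_def by auto
    have "v = B\<^sup>T *\<^sub>v (C *\<^sub>v v)" if "v \<in> carrier_vec n" for v
      using assoc_mult_mat_vec[of "B\<^sup>T" n n C n v] C B that by simp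
    moreover have "C *\<^sub>v v \<in> carrier_vec n" if "v \<in> carrier_vec n" for v using C that by simp
    ultimately have "carrier_vec n \<subseteq> W" unfolding W' by blast
    moreover have "W \<subseteq> carrier_vec n" unfolding W' using B by auto
    ultimately show ?thesis by blast
  qed
  show ?thesis using full[OF A] full[OF torus_act_positively_represents[OF A t]] by simp
qed

section \<open>Equal minors\<close>

lemma three_term_strict_ln_plucker:
  assumes A: "positively_represents k n A U"
  shows "three_term_strict k n (\<lambda>I. ln (plucker A I))"
  unfolding three_term_strict_def
proof (intro allI impI)
  fix R a b c d
  assume asm: "R \<subseteq> {..<n} \<and> card R + 2 = k \<and> a < b \<and> b < c \<and> c < d \<and> d < n \<and> {a, b, c, d} \<inter> R = {}"
  then have fin: "finite R" using finite_subset by auto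
  have pos: "plucker A (insert x (insert y R)) > 0"
    if "x \<noteq> y" "x \<in> {a, b, c, d}" "y \<in> {a, b, c, d}" for x y
  proof -
    have "insert x (insert y R) \<in> ksubsets k n"
      using asm that fin by (auto simp: ksubsets_def)
    then show ?thesis using A by (simp add: positively_represents_def)
  qed
  let ?p = "\<lambda>x y. plucker A (insert x (insert y R))"
  have p: "?p a b > 0" "?p c d > 0" "?p a c > 0" "?p b d > 0" "?p a d > 0" "?p b c > 0"
    using asm by (auto intro!: pos)
  have rel: "?p a c * ?p b d = ?p a b * ?p c d + ?p a d * ?p b c"
    using asm p A by (intro plucker_three_term[of A k n])
      (auto simp: positively_represents_def represents_def)
  have "?p a b * ?p c d < ?p a c * ?p b d" "?p a d * ?p b c < ?p a c * ?p b d"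
    unfolding rel using p by simp_all
  then have "ln (?p a b * ?p c d) < ln (?p a c * ?p b d)" "ln (?p a d * ?p b c) < ln (?p a c * ?p b d)"
    using p by simp_all
  then show "ln (?p a b) + ln (?p c d) < ln (?p a c) + ln (?p b d) \<and>
    ln (?p a d) + ln (?p b c) < ln (?p a c) + ln (?p b d)"
    using p by (simp add: ln_mult)
qed

lemma three_term_strict_diff_sum:
  assumes "three_term_strict k n F"
  shows "three_term_strict k n (\<lambda>I. F I - sum x I)"
  unfolding three_term_strict_def
proof (intro allI impI)
  fix R a b c d
  assume asm: "R \<subseteq> {..<n} \<and> card R + 2 = k \<and> a < b \<and> b < c \<and> c < d \<and> d < n \<and> {a, b, c, d} \<inter> R = {}"
  then have fin: "finite R" using finite_subset by auto
  have sums: "sum x (insert u (insert v R)) = x u + x v + sum x R"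
    if "u < v" "u \<in> {a, b, c, d}" "v \<in> {a, b, c, d}" for u v
    using asm that fin by (auto simp: add.assoc)
  have e: "sum x (insert a (insert b R)) = x a + x b + sum x R"
    "sum x (insert c (insert d R)) = x c + x d + sum x R"
    "sum x (insert a (insert c R)) = x a + x c + sum x R"
    "sum x (insert b (insert d R)) = x b + x d + sum x R"
    "sum x (insert a (insert d R)) = x a + x d + sum x R"
    "sum x (insert b (insert c R)) = x b + x c + sum x R"
    using asm by (auto intro!: sums simp del: sum.insert)
  have "F (insert a (insert b R)) + F (insert c (insert d R))
          < F (insert a (insert c R)) + F (insert b (insert d R)) \<and>
        F (insert a (insert d R)) + F (insert b (insert c R))
          < F (insert a (insert c R)) + F (insert b (insert d R))"
    using assms asm unfolding three_term_strict_def by blast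
  then show "F (insert a (insert b R)) - sum x (insert a (insert b R)) +
     (F (insert c (insert d R)) - sum x (insert c (insert d R)))
     < F (insert a (insert c R)) - sum x (insert a (insert c R)) +
     (F (insert b (insert d R)) - sum x (insert b (insert d R))) \<and>
     F (insert a (insert d R)) - sum x (insert a (insert d R)) +
     (F (insert b (insert c R)) - sum x (insert b (insert c R)))
     < F (insert a (insert c R)) - sum x (insert a (insert c R)) +
     (F (insert b (insert d R)) - sum x (insert b (insert d R)))"
    unfolding e by simp
qed

text \<open>
  Taking logarithms turns the torus action into subtracting a linear function \<open>sum x\<close> from
  \<open>ln (plucker A I)\<close>. The weights that make the result vanish on \<open>S\<close> exist and are unique up to a
  constant, which corresponds to a homothety; linear functions do not affect the three-term
  inequalities, so the remaining coordinates become smaller than 1.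
\<close>

lemma (in maximal_sorted) unique_equalizing_torus_element:
  assumes A: "positively_represents k n A U"
  shows "\<exists>t. (\<forall>i. t i > 0) \<and>
    (\<forall>I\<in>S. (\<Prod>i\<in>I. t i) * plucker A I = 1) \<and>
    (\<forall>J\<in>ksubsets k n - S. (\<Prod>i\<in>J. t i) * plucker A J < 1) \<and>
    (\<forall>s. (\<forall>i<n. s i > 0) \<and>
           (\<forall>I\<in>S. \<forall>J\<in>S. (\<Prod>i\<in>I. s i) * plucker A I = (\<Prod>i\<in>J. s i) * plucker A J)
         \<longrightarrow> (\<exists>c>0. \<forall>i<n. s i = c * t i))"
proof -
  let ?F = "\<lambda>I. ln (plucker A I)"
  have pos: "plucker A I > 0" if "I \<in> ksubsets k n" for I
    using A that by (simp add: positively_represents_def)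
  obtain x where x: "\<And>I. I \<in> S \<Longrightarrow> sum x I = ?F I" using weights_exist[of ?F] by blast
  define t where "t i = exp (- x i)" for i
  have tp: "(\<Prod>i\<in>I. t i) * plucker A I = exp (?F I - sum x I)" if "I \<in> ksubsets k n" for I
  proof -
    have "(\<Prod>i\<in>I. t i) = exp (- sum x I)"
      using exp_sum[OF ksubsets_finite[OF that], of "\<lambda>i. - x i"] by (simp add: t_def sum_negf)
    then show ?thesis using pos[OF that] by (simp add: exp_diff exp_minus field_simps)
  qed
  have on: "(\<Prod>i\<in>I. t i) * plucker A I = 1" if "I \<in> S" for I
    using tp[OF S_ksubsets[OF that]] x[OF that] by simp
  have off: "(\<Prod>i\<in>J. t i) * plucker A J < 1" if "J \<in> ksubsets k n - S" for J
  proof -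
    have "?F J - sum x J < 0"
      using negative_outside[OF three_term_strict_diff_sum[OF three_term_strict_ln_plucker[OF A], of x]] x that
      by simp
    then show ?thesis using tp[of J] that by simp
  qed
  have homothetic: "\<exists>c>0. \<forall>i<n. s i = c * t i"
    if s: "\<And>i. i < n \<Longrightarrow> s i > 0"
      and eq: "\<And>I J. I \<in> S \<Longrightarrow> J \<in> S \<Longrightarrow> (\<Prod>i\<in>I. s i) * plucker A I = (\<Prod>i\<in>J. s i) * plucker A J" for s
  proof -
    define w where "w i = ln (s i) + x i" for i
    have "exp (sum w I) = (\<Prod>i\<in>I. s i) * plucker A I" if "I \<in> S" for I
    proof -
      note I = S_ksubsets[OF that]
      have "exp (sum w I) = exp (\<Sum>i\<in>I. ln (s i)) * exp (sum x I)"
        by (simp add: w_def sum.distrib exp_add)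
      also have "exp (\<Sum>i\<in>I. ln (s i)) = (\<Prod>i\<in>I. s i)"
        unfolding exp_sum[OF ksubsets_finite[OF I]] using I s
        by (intro prod.cong) (auto simp: ksubsets_def)
      also have "exp (sum x I) = plucker A I" using x[OF that] pos[OF I] by simp
      finally show ?thesis .
    qed
    then have "sum w I = sum w J" if "I \<in> S" "J \<in> S" for I J
      using eq[OF that] that by (metis exp_inj_iff)
    then have w: "w i = w 0" if "i < n" for i using constant_of_constant_sums that by blast
    have "s i = exp (w 0) * t i" if "i < n" for i
    proof -
      have "s i = exp (w i) * t i" using s[OF that] by (simp add: w_def t_def exp_add exp_minus)
      then show ?thesis using w[OF that] by simp
    qed
    then show ?thesis by (intro exI[of _ "exp (w 0)"]) auto
  qed
  show ?thesis
  proof (intro exI[of _ t] conjI ballI allI impI)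
    show "t i > 0" for i by (simp add: t_def)
  qed (use on off homothetic in blast)+
qed

theorem theorem8p1:
  fixes k n :: nat and U :: "real vec set" and S :: "nat set set"
  assumes "1 \<le> k" and "k \<le> n"
    and "U \<in> positive_grassmannian k n"
    and "maximal_sorted_subset k n S"
  shows "(\<exists>!U'. U' \<in> positive_grassmannian k n \<and> U' \<in> torus_orbit n U \<and>
            pluckers_equal_on k n S U') \<and>
         (\<forall>U'. U' \<in> positive_grassmannian k n \<and> U' \<in> torus_orbit n U \<and>
            pluckers_equal_on k n S U' \<longrightarrow>
            (\<forall>A. positively_represents k n A U' \<longrightarrow>
               (\<forall>I\<in>S. \<forall>J\<in>ksubsets k n - S. plucker A J < plucker A I)))"
proof -
  obtain A where A: "positively_represents k n A U"
    using positively_represents_exists assms by blast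
  then have rep: "represents k n A U" and Ac: "A \<in> carrier_mat k n"
    by (auto simp: positively_represents_def represents_def)
  have S: "S \<subseteq> ksubsets k n"
    using assms(4) by (auto simp: maximal_sorted_subset_def sorted_subset_def)
  define B where "B t = mat k n (\<lambda>(i, j). t j * A $$ (i, j))" for t
  have B: "positively_represents k n (B t) (torus_act n t U)" if "\<And>i. i < n \<Longrightarrow> t i > 0" for t
    unfolding B_def using torus_act_positively_represents[OF A that] .
  have pB: "plucker (B t) I = (\<Prod>i\<in>I. t i) * plucker A I" if "I \<in> ksubsets k n" for t I
    unfolding B_def using plucker_scale_columns[OF Ac that] .
  obtain t where t: "\<And>i. t i > 0"
    and on: "\<And>I J. I \<in> S \<Longrightarrow> J \<in> S \<Longrightarrow> plucker (B t) I = plucker (B t) J"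
    and off: "\<And>I J. I \<in> S \<Longrightarrow> J \<in> ksubsets k n - S \<Longrightarrow> plucker (B t) J < plucker (B t) I"
    and uniq: "\<forall>s. (\<forall>i<n. s i > 0) \<and> pluckers_equal_on k n S (torus_act n s U)
      \<longrightarrow> torus_act n s U = torus_act n t U"
  \<comment> \<open>for \<open>k = n\<close> there is one Pluecker coordinate and the torus acts trivially, although torus
    elements need not be homothetic\<close>
  proof (cases "k = n")
    case True
    then have "I = {..<n}" if "I \<in> ksubsets k n" for I
      using that by (intro card_subset_eq) (auto simp: ksubsets_def)
    moreover have "S \<noteq> {}"
    proof
      assume "S = {}"
      moreover have "sorted_subset k n {{..<n}}"
        using True by (auto simp: sorted_subset_def ksubsets_def sorted_pair_def)
      ultimately show False using assms(4) unfolding maximal_sorted_subset_def by blast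
    qed
    ultimately have single: "ksubsets k n - S = {}" "\<And>I J. I \<in> S \<Longrightarrow> J \<in> S \<Longrightarrow> I = J"
      using S by blast+
    have fixed: "torus_act n s U = U" if "\<And>i. i < n \<Longrightarrow> s i > 0" for s
      using torus_act_full[of n A U s] A True that by simp
    show thesis
    proof (rule that[of "\<lambda>_. 1"])
      show "plucker (B (\<lambda>_. 1)) I = plucker (B (\<lambda>_. 1)) J" if "I \<in> S" "J \<in> S" for I J
        using single(2)[OF that] by (rule arg_cong)
      show "\<forall>s. (\<forall>i<n. s i > 0) \<and> pluckers_equal_on k n S (torus_act n s U)
        \<longrightarrow> torus_act n s U = torus_act n (\<lambda>_. 1) U"
      proof (intro allI impI)
        fix s :: "nat \<Rightarrow> real"
        assume "(\<forall>i<n. s i > 0) \<and> pluckers_equal_on k n S (torus_act n s U)"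
        then have "torus_act n s U = U" by (intro fixed) blast
        moreover have "torus_act n (\<lambda>_. 1) U = U" by (rule fixed) simp
        ultimately show "torus_act n s U = torus_act n (\<lambda>_. 1) U" by simp
      qed
    qed (use single(1) in auto)
  next
    case False
    then interpret maximal_sorted k n S using assms by unfold_locales auto
    obtain t where t: "\<forall>i. t i > 0"
      and on: "\<forall>I\<in>S. (\<Prod>i\<in>I. t i) * plucker A I = 1"
      and off: "\<forall>J\<in>ksubsets k n - S. (\<Prod>i\<in>J. t i) * plucker A J < 1"
      and uniq: "\<forall>s. (\<forall>i<n. s i > 0) \<and>
           (\<forall>I\<in>S. \<forall>J\<in>S. (\<Prod>i\<in>I. s i) * plucker A I = (\<Prod>i\<in>J. s i) * plucker A J)
         \<longrightarrow> (\<exists>c>0. \<forall>i<n. s i = c * t i)"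
      using unique_equalizing_torus_element[OF A] by (elim exE conjE) (rule that)
    show thesis
    proof (rule that[of t])
      show "t i > 0" for i using t by blast
      show "plucker (B t) I = plucker (B t) J" if "I \<in> S" "J \<in> S" for I J
        using on that S by (simp add: pB subset_iff)
      show "plucker (B t) J < plucker (B t) I" if "I \<in> S" "J \<in> ksubsets k n - S" for I J
        using on off that S by (simp add: pB subset_iff)
      have "torus_act n s U = torus_act n t U"
        if s: "\<forall>i<n. s i > 0" and eq: "pluckers_equal_on k n S (torus_act n s U)" for s
      proof -
        have Bs: "positively_represents k n (B s) (torus_act n s U)" using B s by blast
        have "(\<Prod>i\<in>I. s i) * plucker A I = (\<Prod>i\<in>J. s i) * plucker A J" if "I \<in> S" "J \<in> S" for I J
        proof -
          have "plucker (B s) I = plucker (B s) J"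
            using eq that unfolding pluckers_equal_on_iff[OF assms(2) Bs S] by blast
          then show ?thesis using that S by (simp add: pB subset_iff)
        qed
        then obtain c where "c > 0" "\<forall>i<n. s i = c * t i" using uniq s by blast
        then show ?thesis using torus_act_homothety[OF rep, of s c t] by simp
      qed
      then show "\<forall>s. (\<forall>i<n. s i > 0) \<and> pluckers_equal_on k n S (torus_act n s U)
        \<longrightarrow> torus_act n s U = torus_act n t U" by blast
    qed
  qed
  let ?V = "torus_act n t U"
  note Bt = B[OF t]
  have "?V \<in> positive_grassmannian k n"
    using positively_represents_imp_positive_grassmannian[OF assms(2) Bt] .
  moreover have "?V \<in> torus_orbit n U" using t unfolding torus_orbit_def by blast
  moreover have "pluckers_equal_on k n S ?V"
    unfolding pluckers_equal_on_iff[OF assms(2) Bt S] using on by blast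
  ultimately have V: "?V \<in> positive_grassmannian k n \<and> ?V \<in> torus_orbit n U \<and>
    pluckers_equal_on k n S ?V" by blast
  have eqV: "U' = ?V" if "U' \<in> torus_orbit n U" "pluckers_equal_on k n S U'" for U'
    using that uniq unfolding torus_orbit_def by blast
  have strict: "plucker C J < plucker C I"
    if C: "positively_represents k n C ?V" and I: "I \<in> S" and J: "J \<in> ksubsets k n - S" for C I J
  proof -
    obtain c where "c > 0" "\<And>K. K \<in> ksubsets k n \<Longrightarrow> plucker C K = c * plucker (B t) K"
      using positive_representatives_proportional[OF assms(2) Bt C] by blast
    moreover have "I \<in> ksubsets k n" "J \<in> ksubsets k n" using I J S by auto
    ultimately show ?thesis using off[OF I J] by simp
  qed
  show ?thesis
  proof (intro conjI allI impI ballI)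
    show "\<exists>!U'. U' \<in> positive_grassmannian k n \<and> U' \<in> torus_orbit n U \<and> pluckers_equal_on k n S U'"
      using V eqV by (intro ex1I[of _ ?V]) blast+
  next
    fix U' C I J
    assume "U' \<in> positive_grassmannian k n \<and> U' \<in> torus_orbit n U \<and> pluckers_equal_on k n S U'"
      and C: "positively_represents k n C U'" and IJ: "I \<in> S" "J \<in> ksubsets k n - S"
    then have "U' = ?V" using eqV by blast
    then show "plucker C J < plucker C I" using strict IJ C by blast
  qed
qed

end
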